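(* Suppose $\ell_\theta$ is $\gamma_\theta$-strongly convex in $\theta$ and $L_\theta$-smooth in $(x,y)$ and $\theta$; $\ell_\phi$ is $\gamma_\phi$-strongly convex in $\phi$ and $L_\phi$-smooth in $(x,y)$ and $\phi$; $P(\theta,\phi)$ is $\varepsilon_\theta$-sensitive and $Q(\theta,\phi)$ is $\varepsilon_\phi$-sensitive; and $$\kappa=\max\left(\frac{\gamma_\theta L_\phi\varepsilon_\phi+2\gamma_\phi L_\theta\varepsilon_\theta}{\gamma_\phi(\gamma_\theta-L_\theta\varepsilon_\theta)},\ \frac{\gamma_\phi L_\theta\varepsilon_\theta+2\gamma_\theta L_\phi\varepsilon_\phi}{\gamma_\theta(\gamma_\phi-L_\phi\varepsilon_\phi)},\ \frac{L_\theta\varepsilon_\theta}{\gamma_\theta}+\frac{L_\phi\varepsilon_\phi}{\gamma_\phi}\right)<1.$$ Then the self-consuming multi-model system converges to a stable point $(\theta^*,\phi^* )$. Let $P_{\mathcal H}=P_{\mathcal H}(\theta^*,\phi^* )$ be the distribution of the human-curated data of model $\theta$ after convergence. Then, when $\lambda_{\mathcal H}^\theta$ is varied only through the size of the curated dataset of model $\theta$, $$\frac{\partial J_p(\theta^* )}{\partial\lambda_{\mathcal H}^\theta}=\frac{1}{1-\lambda_{\mathcal H}^\theta}\big\langle\nabla_\theta J_p(\theta^* ),\,S_p\,\mathbb E_{P_{\mathcal H}}[-\nabla_\theta\ell_\theta(\theta^* )]\big\rangle,$$ $$\frac{\partial J_q(\phi^* )}{\partial\lambda_{\mathcal H}^\theta}=\frac{1}{1-\lambda_{\mathcal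 H}^\theta}\big\langle\nabla_\phi J_q(\phi^* ),\,S_q C_q\,\mathbb E_{P_{\mathcal H}}[-\nabla_\theta\ell_\theta(\theta^* )]\big\rangle.$$
   Context: Models. $\Theta,\Phi$ are closed convex subsets of Euclidean spaces; model $\theta\in\Theta$ outputs $x\sim p_\theta(x|y)$, model $\phi\in\Phi$ outputs $y\sim q_\phi(y|x)$; losses $\ell_\theta(x,y)$, $\ell_\phi(x,y)$; rewards $r_\theta(x,y)$, $r_\phi(x,y)$. Training distributions. $P(\theta,\phi)=\lambda_{\mathcal R}^\theta P_{\mathcal R}+\lambda_{\mathcal S}^\theta P_{\mathcal S}(\theta,\phi)+\lambda_{\mathcal H}^\theta P_{\mathcal H}(\theta,\phi)$ is the training distribution of model $\theta$, where $P_{\mathcal R}$ is the fixed real-data distribution, $P_{\mathcal S}(\theta,\phi)$ the distribution of synthetic data and $P_{\mathcal H}(\theta,\phi)$ that of human-curated synthetic data (synthetic/curated samples come from model $\phi$ with fixed fraction $\lambda_\theta^\phi$ and from model $\theta$ itself with fraction $1-\lambda_\theta^\phi$); weights are nonnegative and sum to 1. Similarly $Q(\theta,\phi)=\lambda_{\mathcal R}^\phi Q_{\mathcal R}+\lambda_{\mathcal S}^\phi Q_{\mathcal S}(\theta,\phi)+\lambda_{\mathcal H}^\phi Q_{\mathcal H}(\theta,\phi)$ for model $\phi$. The component distributions are treated as functions of $(\theta,\phi)$ only, not of the mixing weights. Dynamics. In each round $\theta_{t+1}=\arg\min_\theta\mathbb E_{P_{t+1}}[\ell_\theta(x,y)]$,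 $\phi_{t+1}=\arg\min_\phi\mathbb E_{Q_{t+1}}[\ell_\phi(x,y)]$, with either synchronous updates ($P_{t+1}=P(\theta_t,\phi_t)$, $Q_{t+1}=Q(\theta_t,\phi_t)$) or asynchronous ones ($P_{t+1}=P(\theta_t,\phi_t)$, $Q_{t+1}=Q(\theta_{t+1},\phi_t)$, or symmetrically). A stable point satisfies $\theta^*=\arg\min_\theta\mathbb E_{P(\theta^*,\phi^* )}[\ell_\theta]$, $\phi^*=\arg\min_\phi\mathbb E_{Q(\theta^*,\phi^* )}[\ell_\phi]$. Variation of $\lambda_{\mathcal H}^\theta$. Only the size of model $\theta$'s curated dataset changes, all other data sources being fixed: so the ratio $\lambda_{\mathcal S}^\theta:\lambda_{\mathcal R}^\theta$, the weights of model $\phi$ and the cross-model fractions stay fixed, and $\lambda_{\mathcal H}^\theta<1$. The stable point $(\theta^*,\phi^* )$ is viewed as a function of $\lambda_{\mathcal H}^\theta$. Alignment. $J_p(\theta)=\mathbb E_{y\sim\mathcal E_\theta,\,x\sim p_\theta(x|y)}[r_\theta(x,y)]$ and $J_q(\phi)=\mathbb E_{x\sim\mathcal E_\phi,\,y\sim q_\phi(y|x)}[r_\phi(x,y)]$, with fixed evaluation distributions $\mathcal E_\theta,\mathcal E_\phi$. Matrices. $F_p(\theta,\phi,\lambda_{\mathcal H}^\theta)=\mathbb E_{P(\theta,\phi)}[\nabla_\theta\ell_\theta(x,y)]$, $F_q(\theta,\phi,\lambda_{\mathcal H}^\theta)=\mathbb E_{Q(\theta,\phi)}[\nabla_\phi\ell_\phi(x,y)]$.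 $\nabla_\theta\mathbf F_p,\nabla_\phi\mathbf F_p,\nabla_\theta\mathbf F_q,\nabla_\phi\mathbf F_q$ are their Jacobians in $\theta$, $\phi$ at $(\theta^*,\phi^*,\lambda_{\mathcal H}^\theta)$ (differentiating both the loss gradient and the distribution). Then $S_p=(\nabla_\theta\mathbf F_p-\nabla_\phi\mathbf F_p(\nabla_\phi\mathbf F_q)^{-1}\nabla_\theta\mathbf F_q)^{-1}$, $S_q=(\nabla_\phi\mathbf F_q-\nabla_\theta\mathbf F_q(\nabla_\theta\mathbf F_p)^{-1}\nabla_\phi\mathbf F_p)^{-1}$, $C_q=-\nabla_\theta\mathbf F_q(\nabla_\theta\mathbf F_p)^{-1}$. Standing conventions: all functions are differentiable as needed for these expressions, the stable point is a differentiable function of $\lambda_{\mathcal H}^\theta$, and stability means $F_p(\theta^*,\phi^*,\lambda_{\mathcal H}^\theta)=F_q(\theta^*,\phi^*,\lambda_{\mathcal H}^\theta)=0$ for every $\lambda_{\mathcal H}^\theta$ considered. Strong convexity: $\ell_\theta(\theta)\ge\ell_\theta(\theta')+\nabla_\theta\ell_\theta(\theta')^T(\theta-\theta')+\frac{\gamma_\theta}{2}\|\theta-\theta'\|^2$, $\gamma_\theta>0$ (similarly $\phi$). Smoothness: $\|\nabla_\theta\ell_\theta(x,y)-\nabla_\theta\ell_\theta(x',y')\|\le L_\theta\|(x,y)-(x',y')\|$ and $\|\nabla_\theta\ell_\theta(\theta)-\nabla_\theta\ell_\theta(\theta')\|\le L_\theta\|\theta-\theta'\|$ (similarly $\phi$).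 Sensitivity: $W(P(\theta,\phi),P(\theta',\phi'))\le\varepsilon_\theta\|(\theta,\phi)-(\theta',\phi')\|$ and $W(Q(\theta,\phi),Q(\theta',\phi'))\le\varepsilon_\phi\|(\theta,\phi)-(\theta',\phi')\|$, $W$ the Wasserstein-1 distance. *)

theory Defs
  imports "HOL-Probability.Probability"
begin

section \<open>Measures on the data space\<close>

definition borel_prob :: "'z::topological_space measure \<Rightarrow> bool" where
  "borel_prob M \<longleftrightarrow> prob_space M \<and> sets M = sets borel"

definition mixture :: "(real \<times> 'z::topological_space measure) list \<Rightarrow> 'z measure" where
  "mixture ws = measure_of UNIV (sets borel) (\<lambda>A. \<Sum>(w, M)\<leftarrow>ws. ennreal w * emeasure M A)"

lemma space_mixture [simp]: "space (mixture ws) = UNIV"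
  by (simp add: mixture_def space_measure_of_conv)

lemma sets_mixture [simp]: "sets (mixture ws) = sets borel"
proof -
  have "sigma_sets UNIV (sets (borel :: 'a measure)) = sets borel"
    by (metis sets.sigma_sets_eq space_borel)
  then show ?thesis
    by (simp add: mixture_def sets_measure_of_conv)
qed

lemma emeasure_mixture:
  assumes "\<And>w M. (w, M) \<in> set ws \<Longrightarrow> sets M = sets borel" and "A \<in> sets borel"
  shows "emeasure (mixture ws) A = (\<Sum>(w, M)\<leftarrow>ws. ennreal w * emeasure M A)"
proof -
  let ?f = "\<lambda>A. \<Sum>(w, M)\<leftarrow>ws. ennreal w * emeasure M A"
  have "countably_additive (sets borel) ?f"
    using assms(1)
  proof (induction ws)
    case Nil
    then show ?case by (simp add: countably_additive_def)
  next
    case (Cons a ws)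
    obtain w M where a: "a = (w, M)" by (cases a)
    have M: "sets M = sets borel" using Cons.prems a by auto
    have IH: "countably_additive (sets borel) (\<lambda>A. \<Sum>(w, M)\<leftarrow>ws. ennreal w * emeasure M A)"
      by (rule Cons.IH) (use Cons.prems in auto)
    show ?case
      unfolding countably_additive_def
    proof (intro allI impI)
      fix X :: "nat \<Rightarrow> 'a set"
      assume X: "range X \<subseteq> sets borel" "disjoint_family X" "\<Union> (range X) \<in> sets borel"
      have "(\<Sum>i. ennreal w * emeasure M (X i)) = ennreal w * emeasure M (\<Union> (range X))"
        using X M by (simp add: suminf_emeasure)
      moreover have "(\<Sum>i. \<Sum>(w, M)\<leftarrow>ws. ennreal w * emeasure M (X i)) =
          (\<Sum>(w, M)\<leftarrow>ws. ennreal w * emeasure M (\<Union> (range X)))"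
        using IH X unfolding countably_additive_def by blast
      ultimately show "(\<Sum>i. \<Sum>(w, M)\<leftarrow>a # ws. ennreal w * emeasure M (X i)) =
          (\<Sum>(w, M)\<leftarrow>a # ws. ennreal w * emeasure M (\<Union> (range X)))"
        by (simp add: a flip: suminf_add)
    qed
  qed
  moreover have "positive (sets borel) ?f"
    by (auto simp: positive_def intro!: sum_list_0 cong: map_cong)
  moreover have "sigma_algebra UNIV (sets (borel :: 'a measure))"
    by (metis sets.sigma_algebra_axioms space_borel)
  ultimately show ?thesis
    using assms(2) unfolding mixture_def by (intro emeasure_measure_of_sigma)
qed

text \<open>Law of \<open>(x, y)\<close> when \<open>y\<close> is drawn from \<open>\<mu>\<close> and then \<open>x\<close> from \<open>K y\<close>, and the same with
  the roles of the two coordinates exchanged.\<close>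

definition law_x_given_y ::
    "'y measure \<Rightarrow> ('y \<Rightarrow> 'x measure) \<Rightarrow> ('x::topological_space \<times> 'y::topological_space) measure" where
  "law_x_given_y \<mu> K = \<mu> \<bind> (\<lambda>y. distr (K y) borel (\<lambda>x. (x, y)))"

definition law_y_given_x ::
    "'x measure \<Rightarrow> ('x \<Rightarrow> 'y measure) \<Rightarrow> ('x::topological_space \<times> 'y::topological_space) measure" where
  "law_y_given_x \<nu> K = \<nu> \<bind> (\<lambda>x. distr (K x) borel (\<lambda>y. (x, y)))"

definition couplings :: "'z::topological_space measure \<Rightarrow> 'z measure \<Rightarrow> ('z \<times> 'z) measure set" where
  "couplings M N = {\<pi>. borel_prob \<pi> \<and> distr \<pi> borel fst = M \<and> distr \<pi> borel snd = N}"

definition wasserstein1 :: "'z::metric_space measure \<Rightarrow> 'z measure \<Rightarrow> ennreal" where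
  "wasserstein1 M N = (INF \<pi>\<in>couplings M N. \<integral>\<^sup>+ (z, z'). ennreal (dist z z') \<partial>\<pi>)"

section \<open>Conditions on losses and training distributions\<close>

definition has_gradient :: "('a::real_inner \<Rightarrow> real) \<Rightarrow> 'a \<Rightarrow> 'a filter \<Rightarrow> bool" where
  "has_gradient f D F \<longleftrightarrow> (f has_derivative (\<lambda>h. D \<bullet> h)) F"

text \<open>Derivatives in a parameter are taken within the parameter set, so that nothing depends on
  the values of a function at inadmissible parameters.\<close>

definition loss_gradient ::
    "'a::real_inner set \<Rightarrow> ('a \<Rightarrow> 'z \<Rightarrow> real) \<Rightarrow> ('a \<Rightarrow> 'z \<Rightarrow> 'a) \<Rightarrow> bool" where
  "loss_gradient A l g \<longleftrightarrow> (\<forall>z. \<forall>a\<in>A. has_gradient (\<lambda>a. l a z) (g a z) (at a within A))"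

definition strongly_convex_loss ::
    "real \<Rightarrow> 'a::real_inner set \<Rightarrow> ('a \<Rightarrow> 'z \<Rightarrow> real) \<Rightarrow> ('a \<Rightarrow> 'z \<Rightarrow> 'a) \<Rightarrow> bool" where
  "strongly_convex_loss \<gamma> A l g \<longleftrightarrow>
     (\<forall>z. \<forall>a\<in>A. \<forall>a'\<in>A. l a z \<ge> l a' z + g a' z \<bullet> (a - a') + \<gamma> / 2 * (norm (a - a'))\<^sup>2)"

definition smooth_loss ::
    "real \<Rightarrow> 'a::real_normed_vector set \<Rightarrow> ('a \<Rightarrow> 'z::real_normed_vector \<Rightarrow> 'a) \<Rightarrow> bool" where
  "smooth_loss L A g \<longleftrightarrow>
     (\<forall>a\<in>A. \<forall>z z'. norm (g a z - g a z') \<le> L * norm (z - z')) \<and>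
     (\<forall>a\<in>A. \<forall>a'\<in>A. \<forall>z. norm (g a z - g a' z) \<le> L * norm (a - a'))"

definition sensitive ::
    "real \<Rightarrow> 'a::real_normed_vector set \<Rightarrow> 'b::real_normed_vector set \<Rightarrow>
     ('a \<Rightarrow> 'b \<Rightarrow> 'z::metric_space measure) \<Rightarrow> bool" where
  "sensitive \<epsilon> A B D \<longleftrightarrow>
     (\<forall>a\<in>A. \<forall>a'\<in>A. \<forall>b\<in>B. \<forall>b'\<in>B.
        wasserstein1 (D a b) (D a' b') \<le> ennreal (\<epsilon> * norm ((a, b) - (a', b'))))"

definition kappa :: "real \<Rightarrow> real \<Rightarrow> real \<Rightarrow> real \<Rightarrow> real \<Rightarrow> real \<Rightarrow> real" where
  "kappa g\<theta> L\<theta> e\<theta> g\<phi> L\<phi> e\<phi> =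
     Max {(g\<theta> * L\<phi> * e\<phi> + 2 * g\<phi> * L\<theta> * e\<theta>) / (g\<phi> * (g\<theta> - L\<theta> * e\<theta>)),
          (g\<phi> * L\<theta> * e\<theta> + 2 * g\<theta> * L\<phi> * e\<phi>) / (g\<theta> * (g\<phi> - L\<phi> * e\<phi>)),
          L\<theta> * e\<theta> / g\<theta> + L\<phi> * e\<phi> / g\<phi>}"

section \<open>The self-consuming two-model system\<close>

text \<open>Suffix \<open>p\<close> refers to the model with parameter \<open>\<theta>\<close> (it generates \<open>x\<close> from \<open>y\<close>), suffix \<open>q\<close> to
  the model with parameter \<open>\<phi>\<close> (it generates \<open>y\<close> from \<open>x\<close>).  A data point is a pair \<open>(x, y)\<close>.

  A synthetic pair is a prompt together with the output of a model on it; \<open>prompt_p_own\<close> and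
  \<open>prompt_p_cross\<close> are the laws of the prompts used to produce the synthetic pairs on which model
  \<open>\<theta>\<close> is trained, for the pairs generated by model \<open>\<theta>\<close> itself and by model \<open>\<phi>\<close> respectively.
  The curation mechanism is arbitrary: \<open>curated_p_own\<close> and \<open>curated_p_cross\<close> are the laws of the
  curated pairs for model \<open>\<theta>\<close> that originate from model \<open>\<theta>\<close> and from model \<open>\<phi>\<close>.
  \<open>cross_p\<close> is the fraction of synthetic and of curated data of model \<open>\<theta>\<close> coming from model \<open>\<phi>\<close>.

  \<open>weight_p_real\<close> and \<open>weight_p_syn\<close> give the weights of real and synthetic data of model \<open>\<theta>\<close> as
  functions of the weight of its curated data.  The rewards may depend on the model parameter.\<close>

record ('m, 'n, 'x, 'y) system =
  Theta :: "(real ^ 'm::finite) set"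
  Phi :: "(real ^ 'n::finite) set"
  model_p :: "real ^ 'm \<Rightarrow> 'y \<Rightarrow> 'x measure"
  model_q :: "real ^ 'n \<Rightarrow> 'x \<Rightarrow> 'y measure"
  loss_p :: "real ^ 'm \<Rightarrow> 'x \<times> 'y \<Rightarrow> real"
  loss_q :: "real ^ 'n \<Rightarrow> 'x \<times> 'y \<Rightarrow> real"
  grad_p :: "real ^ 'm \<Rightarrow> 'x \<times> 'y \<Rightarrow> real ^ 'm"
  grad_q :: "real ^ 'n \<Rightarrow> 'x \<times> 'y \<Rightarrow> real ^ 'n"
  reward_p :: "real ^ 'm \<Rightarrow> 'x \<times> 'y \<Rightarrow> real"
  reward_q :: "real ^ 'n \<Rightarrow> 'x \<times> 'y \<Rightarrow> real"
  eval_p :: "'y measure"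
  eval_q :: "'x measure"
  real_p :: "('x \<times> 'y) measure"
  real_q :: "('x \<times> 'y) measure"
  prompt_p_own :: "real ^ 'm \<Rightarrow> real ^ 'n \<Rightarrow> 'y measure"
  prompt_p_cross :: "real ^ 'm \<Rightarrow> real ^ 'n \<Rightarrow> 'x measure"
  prompt_q_own :: "real ^ 'm \<Rightarrow> real ^ 'n \<Rightarrow> 'x measure"
  prompt_q_cross :: "real ^ 'm \<Rightarrow> real ^ 'n \<Rightarrow> 'y measure"
  curated_p_own :: "real ^ 'm \<Rightarrow> real ^ 'n \<Rightarrow> ('x \<times> 'y) measure"
  curated_p_cross :: "real ^ 'm \<Rightarrow> real ^ 'n \<Rightarrow> ('x \<times> 'y) measure"
  curated_q_own :: "real ^ 'm \<Rightarrow> real ^ 'n \<Rightarrow> ('x \<times> 'y) measure"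
  curated_q_cross :: "real ^ 'm \<Rightarrow> real ^ 'n \<Rightarrow> ('x \<times> 'y) measure"
  cross_p :: real
  cross_q :: real
  weight_p_real :: "real \<Rightarrow> real"
  weight_p_syn :: "real \<Rightarrow> real"
  weight_q_real :: real
  weight_q_syn :: real
  weight_q_cur :: real

definition syn_p ::
    "('m::finite, 'n::finite, 'x::topological_space, 'y::topological_space) system \<Rightarrow>
     real ^ 'm \<Rightarrow> real ^ 'n \<Rightarrow> ('x \<times> 'y) measure" where
  "syn_p S \<theta> \<phi> = mixture
     [(1 - cross_p S, law_x_given_y (prompt_p_own S \<theta> \<phi>) (model_p S \<theta>)),
      (cross_p S, law_y_given_x (prompt_p_cross S \<theta> \<phi>) (model_q S \<phi>))]"

definition syn_q ::
    "('m::finite, 'n::finite, 'x::topological_space, 'y::topological_space) system \<Rightarrow>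
     real ^ 'm \<Rightarrow> real ^ 'n \<Rightarrow> ('x \<times> 'y) measure" where
  "syn_q S \<theta> \<phi> = mixture
     [(1 - cross_q S, law_y_given_x (prompt_q_own S \<theta> \<phi>) (model_q S \<phi>)),
      (cross_q S, law_x_given_y (prompt_q_cross S \<theta> \<phi>) (model_p S \<theta>))]"

definition cur_p ::
    "('m::finite, 'n::finite, 'x::topological_space, 'y::topological_space) system \<Rightarrow>
     real ^ 'm \<Rightarrow> real ^ 'n \<Rightarrow> ('x \<times> 'y) measure" where
  "cur_p S \<theta> \<phi> =
     mixture [(1 - cross_p S, curated_p_own S \<theta> \<phi>), (cross_p S, curated_p_cross S \<theta> \<phi>)]"

definition cur_q ::
    "('m::finite, 'n::finite, 'x::topological_space, 'y::topological_space) system \<Rightarrow>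
     real ^ 'm \<Rightarrow> real ^ 'n \<Rightarrow> ('x \<times> 'y) measure" where
  "cur_q S \<theta> \<phi> =
     mixture [(1 - cross_q S, curated_q_own S \<theta> \<phi>), (cross_q S, curated_q_cross S \<theta> \<phi>)]"

text \<open>The argument \<open>h\<close> is the weight of the curated data of model \<open>\<theta>\<close>.\<close>

definition train_p ::
    "('m::finite, 'n::finite, 'x::topological_space, 'y::topological_space) system \<Rightarrow> real \<Rightarrow>
     real ^ 'm \<Rightarrow> real ^ 'n \<Rightarrow> ('x \<times> 'y) measure" where
  "train_p S h \<theta> \<phi> =
     mixture [(weight_p_real S h, real_p S), (weight_p_syn S h, syn_p S \<theta> \<phi>), (h, cur_p S \<theta> \<phi>)]"

definition train_q ::
    "('m::finite, 'n::finite, 'x::topological_space, 'y::topological_space) system \<Rightarrow>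
     real ^ 'm \<Rightarrow> real ^ 'n \<Rightarrow> ('x \<times> 'y) measure" where
  "train_q S \<theta> \<phi> = mixture
     [(weight_q_real S, real_q S), (weight_q_syn S, syn_q S \<theta> \<phi>), (weight_q_cur S, cur_q S \<theta> \<phi>)]"

text \<open>Standing assumptions; \<open>I\<close> is the range over which the weight \<open>h\<close> is varied.  Keeping all data
  sources other than the curated data of model \<open>\<theta>\<close> fixed means that the ratio of
  \<open>weight_p_syn\<close> to \<open>weight_p_real\<close> does not depend on \<open>h\<close>; it is cross-multiplied because either
  weight may vanish.  The integrability clauses say that the expected losses and expected loss
  gradients exist.\<close>

definition admissible ::
    "('m::finite, 'n::finite, 'x::topological_space, 'y::topological_space) system \<Rightarrow>
     real set \<Rightarrow> bool" where
  "admissible S I \<longleftrightarrow>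
     Theta S \<noteq> {} \<and> closed (Theta S) \<and> convex (Theta S) \<and>
     Phi S \<noteq> {} \<and> closed (Phi S) \<and> convex (Phi S) \<and>
     (\<forall>\<theta>\<in>Theta S. model_p S \<theta> \<in> borel \<rightarrow>\<^sub>M prob_algebra borel) \<and>
     (\<forall>\<phi>\<in>Phi S. model_q S \<phi> \<in> borel \<rightarrow>\<^sub>M prob_algebra borel) \<and>
     borel_prob (eval_p S) \<and> borel_prob (eval_q S) \<and>
     borel_prob (real_p S) \<and> borel_prob (real_q S) \<and>
     (\<forall>\<theta>\<in>Theta S. \<forall>\<phi>\<in>Phi S.
        borel_prob (prompt_p_own S \<theta> \<phi>) \<and> borel_prob (prompt_p_cross S \<theta> \<phi>) \<and>
        borel_prob (prompt_q_own S \<theta> \<phi>) \<and> borel_prob (prompt_q_cross S \<theta> \<phi>) \<and>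
        borel_prob (curated_p_own S \<theta> \<phi>) \<and> borel_prob (curated_p_cross S \<theta> \<phi>) \<and>
        borel_prob (curated_q_own S \<theta> \<phi>) \<and> borel_prob (curated_q_cross S \<theta> \<phi>)) \<and>
     cross_p S \<in> {0..1} \<and> cross_q S \<in> {0..1} \<and>
     is_interval I \<and> I \<subseteq> {0..<1} \<and>
     (\<forall>h\<in>I. weight_p_real S h \<ge> 0 \<and> weight_p_syn S h \<ge> 0 \<and>
            weight_p_real S h + weight_p_syn S h + h = 1) \<and>
     (\<forall>h\<in>I. \<forall>h'\<in>I. weight_p_syn S h * weight_p_real S h' = weight_p_syn S h' * weight_p_real S h) \<and>
     weight_q_real S \<ge> 0 \<and> weight_q_syn S \<ge> 0 \<and> weight_q_cur S \<ge> 0 \<and>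
     weight_q_real S + weight_q_syn S + weight_q_cur S = 1 \<and>
     loss_gradient (Theta S) (loss_p S) (grad_p S) \<and>
     loss_gradient (Phi S) (loss_q S) (grad_q S) \<and>
     (\<forall>\<theta>\<in>Theta S. \<forall>\<phi>\<in>Phi S. \<forall>\<theta>'\<in>Theta S. \<forall>M\<in>{real_p S, syn_p S \<theta> \<phi>, cur_p S \<theta> \<phi>}.
        integrable M (loss_p S \<theta>') \<and> integrable M (grad_p S \<theta>')) \<and>
     (\<forall>\<theta>\<in>Theta S. \<forall>\<phi>\<in>Phi S. \<forall>\<phi>'\<in>Phi S. \<forall>M\<in>{real_q S, syn_q S \<theta> \<phi>, cur_q S \<theta> \<phi>}.
        integrable M (loss_q S \<phi>') \<and> integrable M (grad_q S \<phi>'))"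

section \<open>Retraining dynamics\<close>

definition risk_p ::
    "('m::finite, 'n::finite, 'x::topological_space, 'y::topological_space) system \<Rightarrow> real \<Rightarrow>
     real ^ 'm \<Rightarrow> real ^ 'n \<Rightarrow> real ^ 'm \<Rightarrow> real" where
  "risk_p S h \<theta> \<phi> = (\<lambda>\<theta>'. \<integral>z. loss_p S \<theta>' z \<partial>train_p S h \<theta> \<phi>)"

definition risk_q ::
    "('m::finite, 'n::finite, 'x::topological_space, 'y::topological_space) system \<Rightarrow>
     real ^ 'm \<Rightarrow> real ^ 'n \<Rightarrow> real ^ 'n \<Rightarrow> real" where
  "risk_q S \<theta> \<phi> = (\<lambda>\<phi>'. \<integral>z. loss_q S \<phi>' z \<partial>train_q S \<theta> \<phi>)"

definition retrain_p ::
    "('m::finite, 'n::finite, 'x::topological_space, 'y::topological_space) system \<Rightarrow> real \<Rightarrow>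
     real ^ 'm \<Rightarrow> real ^ 'n \<Rightarrow> real ^ 'm" where
  "retrain_p S h \<theta> \<phi> = arg_min (risk_p S h \<theta> \<phi>) (\<lambda>\<theta>'. \<theta>' \<in> Theta S)"

definition retrain_q ::
    "('m::finite, 'n::finite, 'x::topological_space, 'y::topological_space) system \<Rightarrow>
     real ^ 'm \<Rightarrow> real ^ 'n \<Rightarrow> real ^ 'n" where
  "retrain_q S \<theta> \<phi> = arg_min (risk_q S \<theta> \<phi>) (\<lambda>\<phi>'. \<phi>' \<in> Phi S)"

datatype schedule = Synchronous | Theta_First | Phi_First

fun retrain_round ::
    "('m::finite, 'n::finite, 'x::topological_space, 'y::topological_space) system \<Rightarrow> real \<Rightarrow>
     schedule \<Rightarrow> (real ^ 'm) \<times> (real ^ 'n) \<Rightarrow> (real ^ 'm) \<times> (real ^ 'n)" where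
  "retrain_round S h Synchronous (\<theta>, \<phi>) = (retrain_p S h \<theta> \<phi>, retrain_q S \<theta> \<phi>)"
| "retrain_round S h Theta_First (\<theta>, \<phi>) = (let \<theta>' = retrain_p S h \<theta> \<phi> in (\<theta>', retrain_q S \<theta>' \<phi>))"
| "retrain_round S h Phi_First (\<theta>, \<phi>) = (let \<phi>' = retrain_q S \<theta> \<phi> in (retrain_p S h \<theta> \<phi>', \<phi>'))"

definition stable_point ::
    "('m::finite, 'n::finite, 'x::topological_space, 'y::topological_space) system \<Rightarrow> real \<Rightarrow>
     real ^ 'm \<Rightarrow> real ^ 'n \<Rightarrow> bool" where
  "stable_point S h \<theta> \<phi> \<longleftrightarrow>
     is_arg_min (risk_p S h \<theta> \<phi>) (\<lambda>\<theta>'. \<theta>' \<in> Theta S) \<theta> \<and>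
     is_arg_min (risk_q S \<theta> \<phi>) (\<lambda>\<phi>'. \<phi>' \<in> Phi S) \<phi>"

definition converges_to ::
    "('m::finite, 'n::finite, 'x::topological_space, 'y::topological_space) system \<Rightarrow> real \<Rightarrow>
     real ^ 'm \<Rightarrow> real ^ 'n \<Rightarrow> bool" where
  "converges_to S h \<theta> \<phi> \<longleftrightarrow>
     (\<forall>s. \<forall>z\<in>Theta S \<times> Phi S. (\<lambda>t. (retrain_round S h s ^^ t) z) \<longlonglongrightarrow> (\<theta>, \<phi>))"

section \<open>Alignment and its sensitivity to the curated weight\<close>

definition align_p ::
    "('m::finite, 'n::finite, 'x::topological_space, 'y::topological_space) system \<Rightarrow>
     real ^ 'm \<Rightarrow> real" where
  "align_p S \<theta> = (\<integral>z. reward_p S \<theta> z \<partial>law_x_given_y (eval_p S) (model_p S \<theta>))"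

definition align_q ::
    "('m::finite, 'n::finite, 'x::topological_space, 'y::topological_space) system \<Rightarrow>
     real ^ 'n \<Rightarrow> real" where
  "align_q S \<phi> = (\<integral>z. reward_q S \<phi> z \<partial>law_y_given_x (eval_q S) (model_q S \<phi>))"

definition Fp ::
    "('m::finite, 'n::finite, 'x::topological_space, 'y::topological_space) system \<Rightarrow>
     real ^ 'm \<Rightarrow> real ^ 'n \<Rightarrow> real \<Rightarrow> real ^ 'm" where
  "Fp S \<theta> \<phi> h = (\<integral>z. grad_p S \<theta> z \<partial>train_p S h \<theta> \<phi>)"

text \<open>The training distribution of model \<open>\<phi>\<close>, hence \<open>Fq\<close>, does not involve the weight \<open>h\<close>.\<close>

definition Fq ::
    "('m::finite, 'n::finite, 'x::topological_space, 'y::topological_space) system \<Rightarrow>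
     real ^ 'm \<Rightarrow> real ^ 'n \<Rightarrow> real ^ 'n" where
  "Fq S \<theta> \<phi> = (\<integral>z. grad_q S \<phi> z \<partial>train_q S \<theta> \<phi>)"

definition J\<theta>p ::
    "('m::finite, 'n::finite, 'x::topological_space, 'y::topological_space) system \<Rightarrow>
     real ^ 'm \<Rightarrow> real ^ 'n \<Rightarrow> real \<Rightarrow> real ^ 'm ^ 'm" where
  "J\<theta>p S \<theta> \<phi> h = jacobian (\<lambda>\<theta>'. Fp S \<theta>' \<phi> h) (at \<theta> within Theta S)"

definition J\<phi>p ::
    "('m::finite, 'n::finite, 'x::topological_space, 'y::topological_space) system \<Rightarrow>
     real ^ 'm \<Rightarrow> real ^ 'n \<Rightarrow> real \<Rightarrow> real ^ 'n ^ 'm" where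
  "J\<phi>p S \<theta> \<phi> h = jacobian (\<lambda>\<phi>'. Fp S \<theta> \<phi>' h) (at \<phi> within Phi S)"

definition J\<theta>q ::
    "('m::finite, 'n::finite, 'x::topological_space, 'y::topological_space) system \<Rightarrow>
     real ^ 'm \<Rightarrow> real ^ 'n \<Rightarrow> real ^ 'm ^ 'n" where
  "J\<theta>q S \<theta> \<phi> = jacobian (\<lambda>\<theta>'. Fq S \<theta>' \<phi>) (at \<theta> within Theta S)"

definition J\<phi>q ::
    "('m::finite, 'n::finite, 'x::topological_space, 'y::topological_space) system \<Rightarrow>
     real ^ 'm \<Rightarrow> real ^ 'n \<Rightarrow> real ^ 'n ^ 'n" where
  "J\<phi>q S \<theta> \<phi> = jacobian (\<lambda>\<phi>'. Fq S \<theta> \<phi>') (at \<phi> within Phi S)"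

definition schur_p ::
    "('m::finite, 'n::finite, 'x::topological_space, 'y::topological_space) system \<Rightarrow>
     real ^ 'm \<Rightarrow> real ^ 'n \<Rightarrow> real \<Rightarrow> real ^ 'm ^ 'm" where
  "schur_p S \<theta> \<phi> h = J\<theta>p S \<theta> \<phi> h - J\<phi>p S \<theta> \<phi> h ** matrix_inv (J\<phi>q S \<theta> \<phi>) ** J\<theta>q S \<theta> \<phi>"

definition schur_q ::
    "('m::finite, 'n::finite, 'x::topological_space, 'y::topological_space) system \<Rightarrow>
     real ^ 'm \<Rightarrow> real ^ 'n \<Rightarrow> real \<Rightarrow> real ^ 'n ^ 'n" where
  "schur_q S \<theta> \<phi> h = J\<phi>q S \<theta> \<phi> - J\<theta>q S \<theta> \<phi> ** matrix_inv (J\<theta>p S \<theta> \<phi> h) ** J\<phi>p S \<theta> \<phi> h"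

definition Sp ::
    "('m::finite, 'n::finite, 'x::topological_space, 'y::topological_space) system \<Rightarrow>
     real ^ 'm \<Rightarrow> real ^ 'n \<Rightarrow> real \<Rightarrow> real ^ 'm ^ 'm" where
  "Sp S \<theta> \<phi> h = matrix_inv (schur_p S \<theta> \<phi> h)"

definition Sq ::
    "('m::finite, 'n::finite, 'x::topological_space, 'y::topological_space) system \<Rightarrow>
     real ^ 'm \<Rightarrow> real ^ 'n \<Rightarrow> real \<Rightarrow> real ^ 'n ^ 'n" where
  "Sq S \<theta> \<phi> h = matrix_inv (schur_q S \<theta> \<phi> h)"

definition Cq ::
    "('m::finite, 'n::finite, 'x::topological_space, 'y::topological_space) system \<Rightarrow>
     real ^ 'm \<Rightarrow> real ^ 'n \<Rightarrow> real \<Rightarrow> real ^ 'm ^ 'n" where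
  "Cq S \<theta> \<phi> h = - (J\<theta>q S \<theta> \<phi> ** matrix_inv (J\<theta>p S \<theta> \<phi> h))"

text \<open>\<open>\<theta>s\<close> and \<open>\<phi>s\<close> are the coordinates of the stable point as functions of the weight \<open>h\<close>.  The
  parameter sets are required to have interior points because derivatives within a set with empty
  interior do not determine the Jacobians (a lower-dimensional parameter set is to be
  parametrized by coordinates on its affine hull).\<close>

definition regular_at ::
    "('m::finite, 'n::finite, 'x::topological_space, 'y::topological_space) system \<Rightarrow>
     real set \<Rightarrow> (real \<Rightarrow> real ^ 'm) \<Rightarrow> (real \<Rightarrow> real ^ 'n) \<Rightarrow> real \<Rightarrow> bool" where
  "regular_at S I \<theta>s \<phi>s h \<longleftrightarrow>
     interior (Theta S) \<noteq> {} \<and> interior (Phi S) \<noteq> {} \<and>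
     \<theta>s differentiable (at h within I) \<and> \<phi>s differentiable (at h within I) \<and>
     (\<lambda>(\<theta>, \<phi>, h). Fp S \<theta> \<phi> h) differentiable
       (at (\<theta>s h, \<phi>s h, h) within Theta S \<times> Phi S \<times> I) \<and>
     (\<lambda>(\<theta>, \<phi>). Fq S \<theta> \<phi>) differentiable (at (\<theta>s h, \<phi>s h) within Theta S \<times> Phi S)"

end

theory Submission
  imports Defs
begin

text \<open>
  A coupling turns sensitivity into a bound on the change of an expected loss gradient, so each
  retraining map is Lipschitz, with constants \<open>\<alpha> = L\<theta> \<epsilon>\<theta> / \<gamma>\<theta>\<close> and \<open>\<beta> = L\<phi> \<epsilon>\<phi> / \<gamma>\<phi>\<close>.  In the Euclidean
  norm of the pair, every schedule contracts by \<open>\<alpha> + \<beta>\<close>, since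
  \<open>\<alpha>\<^sup>2 + \<beta>\<^sup>2 + \<alpha>\<^sup>2 \<beta>\<^sup>2 \<le> (\<alpha> + \<beta>)\<^sup>2\<close>.  The same monotonicity estimates pass to the derivatives of
  \<open>Fp\<close> and \<open>Fq\<close>: a vector \<open>(u, v)\<close> killed by both satisfies \<open>norm u \<le> \<alpha> norm (u, v)\<close> and
  \<open>norm v \<le> \<beta> norm (u, v)\<close>, hence vanishes, so all Jacobians and Schur complements are invertible.
  Differentiating \<open>Fp = 0\<close> and \<open>Fq = 0\<close> along the curve of stable points gives a block linear system,
  whose right-hand side is explicit because, at a zero of \<open>Fp\<close>, changing the weight from \<open>h\<close> to \<open>k\<close>
  changes \<open>Fp\<close> by \<open>(k - h) / (1 - h)\<close> times the expected gradient over the curated data.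
\<close>

section \<open>Mixtures and couplings\<close>

lemma SUP_weighted_sum_list:
  fixes c :: "'b \<Rightarrow> ennreal" and f :: "'b \<Rightarrow> nat \<Rightarrow> ennreal"
  assumes "\<And>x. x \<in> set xs \<Longrightarrow> incseq (f x)"
  shows "(SUP i. \<Sum>x\<leftarrow>xs. c x * f x i) = (\<Sum>x\<leftarrow>xs. c x * (SUP i. f x i))"
  using assms
proof (induction xs)
  case (Cons a xs)
  have inc: "incseq (\<lambda>i. c x * f x i)" if "x \<in> set (a # xs)" for x
    using Cons.prems[OF that] by (auto simp: incseq_def intro: mult_left_mono)
  have "incseq (\<lambda>i. \<Sum>x\<leftarrow>xs. c x * f x i)"
    using inc by (auto simp: incseq_def intro!: sum_list_mono)
  then have "(SUP i. \<Sum>x\<leftarrow>a # xs. c x * f x i)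
      = (SUP i. c a * f a i) + (SUP i. \<Sum>x\<leftarrow>xs. c x * f x i)"
    using inc[of a] by (simp add: ennreal_SUP_add)
  then show ?case
    using Cons by (simp add: SUP_mult_left_ennreal)
qed simp

text \<open>Both sides are additive and homogeneous in \<open>f\<close>, and on indicators they
  agree by \<open>emeasure_mixture\<close>. The passage to increasing limits is monotone convergence
  in all components at once, which is what \<open>SUP_weighted_sum_list\<close> handles.\<close>

lemma nn_integral_mixture:
  assumes sets: "\<And>w M. (w, M) \<in> set ws \<Longrightarrow> sets M = sets borel"
    and f: "f \<in> borel_measurable borel"
  shows "(\<integral>\<^sup>+z. f z \<partial>mixture ws) = (\<Sum>(w, M)\<leftarrow>ws. ennreal w * (\<integral>\<^sup>+z. f z \<partial>M))"
  using f
proof (induction rule: borel_measurable_induct)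
  case (cong f g)
  then show ?case by (simp cong: nn_integral_cong)
next
  case (set A)
  have "(\<Sum>(w, M)\<leftarrow>ws. ennreal w * (\<integral>\<^sup>+z. indicator A z \<partial>M)) = (\<Sum>(w, M)\<leftarrow>ws. ennreal w * emeasure M A)"
    using set sets by (intro arg_cong[where f = sum_list] map_cong) auto
  then show ?case
    using emeasure_mixture[OF sets set] set by simp
next
  case (mult u c)
  have m: "u \<in> borel_measurable M" if "(w, M) \<in> set ws" for w M
    using sets[OF that] mult by (metis measurable_cong_sets)
  have "(\<Sum>(w, M)\<leftarrow>ws. ennreal w * (\<integral>\<^sup>+z. c * u z \<partial>M))
      = (\<Sum>x\<leftarrow>ws. c * (case x of (w, M) \<Rightarrow> ennreal w * (\<integral>\<^sup>+z. u z \<partial>M)))"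
    using m by (intro arg_cong[where f = sum_list] map_cong)
      (auto simp: nn_integral_cmult mult.left_commute)
  moreover have "u \<in> borel_measurable (mixture ws)"
    using mult by (metis measurable_cong_sets sets_mixture)
  ultimately show ?case
    using mult by (simp add: nn_integral_cmult sum_list_const_mult)
next
  case (add u v)
  have m: "u \<in> borel_measurable M" "v \<in> borel_measurable M" if "(w, M) \<in> set ws" for w M
    using sets[OF that] add by (metis measurable_cong_sets)+
  have "(\<Sum>(w, M)\<leftarrow>ws. ennreal w * (\<integral>\<^sup>+z. v z + u z \<partial>M))
      = (\<Sum>x\<leftarrow>ws. (case x of (w, M) \<Rightarrow> ennreal w * (\<integral>\<^sup>+z. v z \<partial>M))
          + (case x of (w, M) \<Rightarrow> ennreal w * (\<integral>\<^sup>+z. u z \<partial>M)))"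
    using m by (intro arg_cong[where f = sum_list] map_cong)
      (auto simp: nn_integral_add distrib_left)
  moreover have "u \<in> borel_measurable (mixture ws)" "v \<in> borel_measurable (mixture ws)"
    using add by (metis measurable_cong_sets sets_mixture)+
  ultimately show ?case
    using add by (simp add: nn_integral_add sum_list_addf)
next
  case (seq U)
  have m: "U i \<in> borel_measurable M" if "(w, M) \<in> set ws" for w M i
    using sets[OF that] seq by (metis measurable_cong_sets)
  have "U i \<in> borel_measurable (mixture ws)" for i
    using seq by (metis measurable_cong_sets sets_mixture)
  then have "(\<integral>\<^sup>+z. (SUP i. U i) z \<partial>mixture ws) = (SUP i. \<integral>\<^sup>+z. U i z \<partial>mixture ws)"
    using nn_integral_monotone_convergence_SUP[OF seq(3), of "mixture ws"] by (simp add: image_comp)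
  also have "\<dots> = (SUP i. \<Sum>x\<leftarrow>ws. ennreal (fst x) * (\<integral>\<^sup>+z. U i z \<partial>snd x))"
    by (simp add: seq case_prod_unfold)
  also have "\<dots> = (\<Sum>x\<leftarrow>ws. ennreal (fst x) * (SUP i. \<integral>\<^sup>+z. U i z \<partial>snd x))"
    using seq(3) by (intro SUP_weighted_sum_list)
      (auto simp: incseq_def le_fun_def intro!: nn_integral_mono)
  also have "\<dots> = (\<Sum>x\<leftarrow>ws. ennreal (fst x) * (\<integral>\<^sup>+z. (SUP i. U i) z \<partial>snd x))"
    using m nn_integral_monotone_convergence_SUP[OF seq(3)]
    by (intro arg_cong[where f = sum_list] map_cong) (auto simp: image_comp)
  finally show ?case
    by (simp add: case_prod_unfold)
qed

lemma nn_integral_mixture_eq_integral: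
  fixes f :: "'z::topological_space \<Rightarrow> real"
  assumes "\<And>w M. (w, M) \<in> set ws \<Longrightarrow> 0 \<le> w \<and> sets M = sets borel \<and> integrable M f"
    and "f \<in> borel_measurable borel" and nonneg: "\<And>z. 0 \<le> f z"
  shows "(\<integral>\<^sup>+z. f z \<partial>mixture ws) = ennreal (\<Sum>(w, M)\<leftarrow>ws. w * (\<integral>z. f z \<partial>M))"
proof -
  \<comment> \<open>Nonnegativity of the real sum is carried through the induction, because
    \<open>ennreal\<close> respects addition only for nonnegative summands.\<close>
  have "(\<Sum>(w, M)\<leftarrow>ws. ennreal w * (\<integral>\<^sup>+z. f z \<partial>M)) = ennreal (\<Sum>(w, M)\<leftarrow>ws. w * (\<integral>z. f z \<partial>M))
      \<and> 0 \<le> (\<Sum>(w, M)\<leftarrow>ws. w * (\<integral>z. f z \<partial>M))"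
    using assms(1)
  proof (induction ws)
    case (Cons a ws)
    obtain w M where a: "a = (w, M)" by force
    have "0 \<le> w" "integrable M f" using Cons.prems[of w M] a by auto
    then have "ennreal w * (\<integral>\<^sup>+z. f z \<partial>M) = ennreal (w * (\<integral>z. f z \<partial>M))" "0 \<le> w * (\<integral>z. f z \<partial>M)"
      using nonneg by (simp_all add: nn_integral_eq_integral ennreal_mult)
    moreover have "(\<Sum>(w, M)\<leftarrow>ws. ennreal w * (\<integral>\<^sup>+z. f z \<partial>M)) = ennreal (\<Sum>(w, M)\<leftarrow>ws. w * (\<integral>z. f z \<partial>M))
      \<and> 0 \<le> (\<Sum>(w, M)\<leftarrow>ws. w * (\<integral>z. f z \<partial>M))"
      by (rule Cons.IH) (use Cons.prems in auto)
    ultimately show ?case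
      by (simp add: a)
  qed simp
  then show ?thesis
    using assms by (subst nn_integral_mixture) auto
qed

text \<open>The nonnegative case \<open>*\<close> is read off from
  \<open>nn_integral_mixture_eq_integral\<close>; a general \<open>f\<close> is the difference of
  its positive and negative parts, each of which is integrable over every component.\<close>

lemma integral_mixture_real:
  fixes f :: "'z::topological_space \<Rightarrow> real"
  assumes ws: "\<And>w M. (w, M) \<in> set ws \<Longrightarrow> 0 \<le> w \<and> sets M = sets borel \<and> integrable M f"
    and f: "f \<in> borel_measurable borel"
  shows "integrable (mixture ws) f"
    and "(\<integral>z. f z \<partial>mixture ws) = (\<Sum>(w, M)\<leftarrow>ws. w * (\<integral>z. f z \<partial>M))"
proof -
  have f': "f \<in> borel_measurable (mixture ws)"
    using f by (metis measurable_cong_sets sets_mixture)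
  have *: "integrable (mixture ws) g \<and> (\<integral>z. g z \<partial>mixture ws) = (\<Sum>(w, M)\<leftarrow>ws. w * (\<integral>z. g z \<partial>M))"
    if "g \<in> borel_measurable borel" "\<And>z. 0 \<le> g z" "\<And>w M. (w, M) \<in> set ws \<Longrightarrow> integrable M g" for g
  proof -
    have "g \<in> borel_measurable (mixture ws)"
      using that by (metis measurable_cong_sets sets_mixture)
    moreover have "(\<integral>\<^sup>+z. g z \<partial>mixture ws) = ennreal (\<Sum>(w, M)\<leftarrow>ws. w * (\<integral>z. g z \<partial>M))"
      using that ws by (intro nn_integral_mixture_eq_integral) auto
    moreover have "0 \<le> (\<Sum>(w, M)\<leftarrow>ws. w * (\<integral>z. g z \<partial>M))"
      using that ws by (intro sum_list_nonneg) (auto intro!: mult_nonneg_nonneg)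
    ultimately show ?thesis
      using that by (intro conjI integrableI_nn_integral_finite integral_eq_nn_integral[THEN trans]) auto
  qed
  let ?p = "\<lambda>z. max 0 (f z)" and ?n = "\<lambda>z. max 0 (- f z)"
  have p: "integrable (mixture ws) ?p \<and> (\<integral>z. ?p z \<partial>mixture ws) = (\<Sum>(w, M)\<leftarrow>ws. w * (\<integral>z. ?p z \<partial>M))"
    by (rule *) (use f ws in auto)
  have n: "integrable (mixture ws) ?n \<and> (\<integral>z. ?n z \<partial>mixture ws) = (\<Sum>(w, M)\<leftarrow>ws. w * (\<integral>z. ?n z \<partial>M))"
    by (rule *) (use f ws in auto)
  have eq: "f = (\<lambda>z. ?p z - ?n z)" by auto
  show "integrable (mixture ws) f"
    by (subst eq) (use p n in auto)
  have "(\<Sum>(w, M)\<leftarrow>ws. w * (\<integral>z. f z \<partial>M))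
      = (\<Sum>x\<leftarrow>ws. (case x of (w, M) \<Rightarrow> w * (\<integral>z. ?p z \<partial>M)) - (case x of (w, M) \<Rightarrow> w * (\<integral>z. ?n z \<partial>M)))"
  proof (intro arg_cong[where f = sum_list] map_cong refl)
    fix x assume x: "x \<in> set ws"
    obtain w M where "x = (w, M)" by force
    then have "integrable M f" using ws x by auto
    then have "(\<integral>z. f z \<partial>M) = (\<integral>z. ?p z \<partial>M) - (\<integral>z. ?n z \<partial>M)"
      by (subst eq, subst Bochner_Integration.integral_diff) auto
    then show "(case x of (w, M) \<Rightarrow> w * (\<integral>z. f z \<partial>M))
        = (case x of (w, M) \<Rightarrow> w * (\<integral>z. ?p z \<partial>M)) - (case x of (w, M) \<Rightarrow> w * (\<integral>z. ?n z \<partial>M))"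
      by (simp add: \<open>x = (w, M)\<close> right_diff_distrib)
  qed
  then show "(\<integral>z. f z \<partial>mixture ws) = (\<Sum>(w, M)\<leftarrow>ws. w * (\<integral>z. f z \<partial>M))"
    using p n by (subst eq, subst Bochner_Integration.integral_diff)
      (auto simp: case_prod_unfold simp flip: sum_list_subtractf)
qed

text \<open>Integrability comes from the real case applied to the norm, the formula from the real
  case applied to each coordinate.\<close>

lemma integral_mixture:
  fixes f :: "'z::topological_space \<Rightarrow> 'b::euclidean_space"
  assumes ws: "\<And>w M. (w, M) \<in> set ws \<Longrightarrow> 0 \<le> w \<and> sets M = sets borel \<and> integrable M f"
    and f: "f \<in> borel_measurable borel"
  shows "integrable (mixture ws) f"
    and "(\<integral>z. f z \<partial>mixture ws) = (\<Sum>(w, M)\<leftarrow>ws. w *\<^sub>R (\<integral>z. f z \<partial>M))"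
proof -
  have "integrable (mixture ws) (\<lambda>z. norm (f z))"
    by (rule integral_mixture_real) (use ws f in auto)
  moreover have "f \<in> borel_measurable (mixture ws)"
    using f by (metis measurable_cong_sets sets_mixture)
  ultimately show int: "integrable (mixture ws) f"
    by (simp add: integrable_norm_iff)
  show "(\<integral>z. f z \<partial>mixture ws) = (\<Sum>(w, M)\<leftarrow>ws. w *\<^sub>R (\<integral>z. f z \<partial>M))"
  proof (rule euclidean_eqI)
    fix b :: 'b assume "b \<in> Basis"
    have "(\<integral>z. f z \<partial>mixture ws) \<bullet> b = (\<integral>z. f z \<bullet> b \<partial>mixture ws)"
      using int by simp
    also have "\<dots> = (\<Sum>(w, M)\<leftarrow>ws. w * (\<integral>z. f z \<bullet> b \<partial>M))"
      by (rule integral_mixture_real) (use ws f in auto)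
    also have "\<dots> = (\<Sum>(w, M)\<leftarrow>ws. w *\<^sub>R (\<integral>z. f z \<partial>M)) \<bullet> b"
      using ws
    proof (induction ws)
      case (Cons a ws)
      have "(\<Sum>(w, M)\<leftarrow>ws. w * (\<integral>z. f z \<bullet> b \<partial>M)) = (\<Sum>(w, M)\<leftarrow>ws. w *\<^sub>R (\<integral>z. f z \<partial>M)) \<bullet> b"
        by (rule Cons.IH) (use Cons.prems in auto)
      then show ?case
        using Cons.prems[of "fst a" "snd a"] by (simp add: case_prod_unfold inner_add_left)
    qed simp
    finally show "(\<integral>z. f z \<partial>mixture ws) \<bullet> b = (\<Sum>(w, M)\<leftarrow>ws. w *\<^sub>R (\<integral>z. f z \<partial>M)) \<bullet> b" .
  qed
qed

section \<open>Couplings and the Wasserstein distance\<close>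

lemma borel_measurable_fst: "fst \<in> borel_measurable borel"
  and borel_measurable_snd: "snd \<in> borel_measurable borel"
  by (intro borel_measurable_continuous_onI continuous_on_fst continuous_on_snd continuous_on_id)+

lemma ex_coupling_less:
  assumes "wasserstein1 M N < r"
  obtains \<pi> where "\<pi> \<in> couplings M N" "(\<integral>\<^sup>+ (z, z'). ennreal (dist z z') \<partial>\<pi>) < r"
  using assms unfolding wasserstein1_def Inf_less_iff by auto

text \<open>The infimum over an empty set of couplings is infinite, so a finite distance provides a
  coupling, and \<open>M\<close> is a marginal of that probability measure. Applied to a training
  distribution and itself, this turns the sensitivity bound into the fact that the distribution has
  mass one.\<close>

lemma borel_prob_if_wasserstein1_finite:
  fixes M N :: "'z::{metric_space, second_countable_topology} measure"
  assumes "wasserstein1 M N < \<infinity>"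
  shows "borel_prob M"
proof -
  obtain \<pi> where \<pi>: "\<pi> \<in> couplings M N"
    using ex_coupling_less[OF assms] by metis
  then interpret prob_space \<pi>
    by (simp add: couplings_def borel_prob_def)
  have "fst \<in> borel_measurable \<pi>"
    using \<pi> borel_measurable_fst by (auto simp: couplings_def borel_prob_def cong: measurable_cong_sets)
  then show ?thesis
    using \<pi> prob_space_distr[of fst borel] by (auto simp: couplings_def borel_prob_def)
qed

text \<open>The easy half of Kantorovich-Rubinstein duality, for vector-valued functions: under a
  coupling the difference of the integrals is the integral of \<open>g (fst p) - g (snd p)\<close>.
  The slack \<open>e\<close> stands for a near-optimal coupling, since attainment of the infimum is
  not established, and it tends to 0 at the end.\<close>

lemma norm_integral_diff_le_wasserstein1:
  fixes g :: "'z::{real_normed_vector, second_countable_topology} \<Rightarrow> 'a::euclidean_space"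
  assumes lip: "\<And>z z'. norm (g z - g z') \<le> L * norm (z - z')"
    and int: "integrable M g" "integrable N g"
    and W: "wasserstein1 M N \<le> ennreal r" and "0 \<le> r" "0 \<le> L"
  shows "norm ((\<integral>z. g z \<partial>M) - (\<integral>z. g z \<partial>N)) \<le> L * r"
proof -
  have *: "norm ((\<integral>z. g z \<partial>M) - (\<integral>z. g z \<partial>N)) \<le> L * (r + e)" if "0 < e" for e
  proof -
    have "wasserstein1 M N < ennreal (r + e)"
      using W that \<open>0 \<le> r\<close> by (smt (verit) ennreal_lessI order_le_less_trans)
    then obtain \<pi> where \<pi>: "\<pi> \<in> couplings M N"
      and d: "(\<integral>\<^sup>+ (z, z'). ennreal (dist z z') \<partial>\<pi>) < ennreal (r + e)"
      by (rule ex_coupling_less)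
    have sets: "sets \<pi> = sets borel" and M: "M = distr \<pi> borel fst" and N: "N = distr \<pi> borel snd"
      using \<pi> by (auto simp: couplings_def borel_prob_def)
    have fst: "fst \<in> borel_measurable \<pi>" and snd: "snd \<in> borel_measurable \<pi>"
      using borel_measurable_fst borel_measurable_snd by (simp_all add: measurable_cong_sets[OF sets refl])
    have g: "g \<in> borel_measurable borel"
      using int(1) M by (metis borel_measurable_integrable measurable_cong_sets sets_distr)
    have i: "integrable \<pi> (\<lambda>p. g (fst p))" "integrable \<pi> (\<lambda>p. g (snd p))"
      using int integrable_distr[OF fst, of g] integrable_distr[OF snd, of g] M N by auto
    have "(\<integral>z. g z \<partial>M) - (\<integral>z. g z \<partial>N) = (\<integral>p. g (fst p) - g (snd p) \<partial>\<pi>)"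
      using i fst snd g by (simp add: M N integral_distr)
    then have "ennreal (norm ((\<integral>z. g z \<partial>M) - (\<integral>z. g z \<partial>N)))
        \<le> (\<integral>\<^sup>+p. norm (g (fst p) - g (snd p)) \<partial>\<pi>)"
      using i by (metis Bochner_Integration.integrable_diff integral_norm_bound_ennreal)
    also have "\<dots> \<le> (\<integral>\<^sup>+p. ennreal L * (case p of (z, z') \<Rightarrow> ennreal (dist z z')) \<partial>\<pi>)"
      using lip \<open>0 \<le> L\<close>
      by (intro nn_integral_mono) (auto simp: dist_norm ennreal_leI simp flip: ennreal_mult)
    also have "\<dots> = ennreal L * (\<integral>\<^sup>+ (z, z'). ennreal (dist z z') \<partial>\<pi>)"
    proof (rule nn_integral_cmult)
      have "(\<lambda>p. ennreal (dist (fst p) (snd p))) \<in> borel_measurable \<pi>"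
        using fst snd by measurable
      then show "(\<lambda>(z, z'). ennreal (dist z z')) \<in> borel_measurable \<pi>"
        by (simp add: case_prod_unfold)
    qed
    also have "\<dots> \<le> ennreal (L * (r + e))"
      using d \<open>0 \<le> L\<close> \<open>0 \<le> r\<close> \<open>0 < e\<close> by (auto simp: ennreal_mult intro!: mult_left_mono)
    finally show ?thesis
      using \<open>0 \<le> L\<close> \<open>0 \<le> r\<close> \<open>0 < e\<close> by (simp add: ennreal_le_iff)
  qed
  have "((\<lambda>e. L * (r + e)) \<longlongrightarrow> L * (r + 0)) (at_right 0)"
    by (intro tendsto_intros)
  then have "norm ((\<integral>z. g z \<partial>M) - (\<integral>z. g z \<partial>N)) \<le> L * (r + 0)"
    by (rule tendsto_lowerbound) (use * in \<open>auto simp: eventually_at_filter\<close>)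
  then show ?thesis by simp
qed

section \<open>Risks depending on a deployed decision\<close>

text \<open>A family of risks \<open>\<lambda>a. \<integral>l a dD(i)\<close>, where the index \<open>i\<close> is the pair of deployed parameters.\<close>

locale decision_dependent_risk =
  fixes A :: "'a::euclidean_space set"
    and l :: "'a \<Rightarrow> 'z::{real_normed_vector, second_countable_topology} \<Rightarrow> real"
    and g :: "'a \<Rightarrow> 'z \<Rightarrow> 'a"
    and K :: "'i::metric_space set"
    and D :: "'i \<Rightarrow> 'z measure"
    and \<gamma> L \<epsilon> :: real
  assumes A: "A \<noteq> {}" "closed A" "convex A"
    and \<gamma>: "0 < \<gamma>" and L: "0 \<le> L" and \<epsilon>: "0 \<le> \<epsilon>"
    and strongly_convex: "strongly_convex_loss \<gamma> A l g"
    and smooth: "smooth_loss L A g"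
    and integrable_loss: "\<And>i a. i \<in> K \<Longrightarrow> a \<in> A \<Longrightarrow> integrable (D i) (l a)"
    and integrable_gradient: "\<And>i a. i \<in> K \<Longrightarrow> a \<in> A \<Longrightarrow> integrable (D i) (g a)"
    and sensitive: "\<And>i j. i \<in> K \<Longrightarrow> j \<in> K \<Longrightarrow> wasserstein1 (D i) (D j) \<le> ennreal (\<epsilon> * dist i j)"
begin

definition risk :: "'i \<Rightarrow> 'a \<Rightarrow> real" where
  "risk i a = (\<integral>z. l a z \<partial>D i)"

definition G :: "'i \<Rightarrow> 'a \<Rightarrow> 'a" where
  "G i a = (\<integral>z. g a z \<partial>D i)"

definition minimizer :: "'i \<Rightarrow> 'a" where
  "minimizer i = arg_min (risk i) (\<lambda>a. a \<in> A)"

section \<open>Convexity, Lipschitz and monotonicity estimates for the expected gradient\<close>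

lemma prob_space_D:
  assumes "i \<in> K"
  shows "prob_space (D i)"
proof -
  have "wasserstein1 (D i) (D i) < \<infinity>"
    using sensitive[OF assms assms] by (metis ennreal_less_top infinity_ennreal_def order_le_less_trans)
  then show ?thesis
    using borel_prob_if_wasserstein1_finite by (auto simp: borel_prob_def)
qed

text \<open>Integrating the pointwise inequality makes \<open>G i a'\<close> a strong subgradient of
  \<open>risk i\<close> at \<open>a'\<close>. This is the link between \<open>G\<close> and
  \<open>risk\<close> in all that follows; there is no differentiation under the integral
  sign.\<close>

lemma risk_strongly_convex:
  assumes i: "i \<in> K" and a: "a \<in> A" and a': "a' \<in> A"
  shows "risk i a' + G i a' \<bullet> (a - a') + \<gamma> / 2 * (norm (a - a'))\<^sup>2 \<le> risk i a"
proof -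
  interpret prob_space "D i" by (rule prob_space_D[OF i])
  note int = integrable_loss[OF i a] integrable_loss[OF i a'] integrable_gradient[OF i a']
  have "(\<integral>z. l a' z + g a' z \<bullet> (a - a') + \<gamma> / 2 * (norm (a - a'))\<^sup>2 \<partial>D i) \<le> (\<integral>z. l a z \<partial>D i)"
    using strongly_convex a a' int by (intro integral_mono) (auto simp: strongly_convex_loss_def)
  then show ?thesis
    using int by (simp add: risk_def G_def prob_space)
qed

lemma G_lipschitz:
  assumes i: "i \<in> K" and a: "a \<in> A" and a': "a' \<in> A"
  shows "norm (G i a - G i a') \<le> L * norm (a - a')"
proof -
  interpret prob_space "D i" by (rule prob_space_D[OF i])
  note int = integrable_gradient[OF i a] integrable_gradient[OF i a']
  have "norm (G i a - G i a') = norm (\<integral>z. g a z - g a' z \<partial>D i)"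
    using int by (simp add: G_def)
  also have "\<dots> \<le> (\<integral>z. norm (g a z - g a' z) \<partial>D i)"
    by (rule integral_norm_bound)
  also have "\<dots> \<le> (\<integral>z. L * norm (a - a') \<partial>D i)"
    using smooth a a' int by (intro integral_mono) (auto simp: smooth_loss_def)
  finally show ?thesis
    by (simp add: prob_space)
qed

lemma G_sensitive:
  assumes "i \<in> K" "j \<in> K" "a \<in> A"
  shows "norm (G i a - G j a) \<le> L * (\<epsilon> * dist i j)"
  unfolding G_def
  by (rule norm_integral_diff_le_wasserstein1)
    (use assms smooth sensitive integrable_gradient L \<epsilon> in \<open>auto simp: smooth_loss_def\<close>)

text \<open>Add the strong convexity inequalities at \<open>a\<close> and at \<open>a'\<close>: the
  risks cancel and the two halves of \<gamma> add up.\<close>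

lemma G_monotone:
  assumes i: "i \<in> K" and a: "a \<in> A" and a': "a' \<in> A"
  shows "\<gamma> * (norm (a - a'))\<^sup>2 \<le> (G i a - G i a') \<bullet> (a - a')"
proof -
  have "risk i a' + G i a' \<bullet> (a - a') + \<gamma> / 2 * (norm (a - a'))\<^sup>2 \<le> risk i a"
    "risk i a + G i a \<bullet> (a' - a) + \<gamma> / 2 * (norm (a' - a))\<^sup>2 \<le> risk i a'"
    using risk_strongly_convex assms by auto
  then show ?thesis
    by (simp add: norm_minus_commute[of a' a] inner_diff_left inner_diff_right)
qed

text \<open>The difference splits into a change of decision under \<open>D i\<close>, which is
  strongly monotone, and a change of distribution at \<open>a'\<close>, which Cauchy-Schwarz and
  sensitivity bound. Both the contraction of retraining and the invertibility of the Jacobians rest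
  on this inequality.\<close>

lemma G_monotone_sensitive:
  assumes i: "i \<in> K" and j: "j \<in> K" and a: "a \<in> A" and a': "a' \<in> A"
  shows "\<gamma> * (norm (a - a'))\<^sup>2 - L * \<epsilon> * dist i j * norm (a - a') \<le> (G i a - G j a') \<bullet> (a - a')"
proof -
  have "\<bar>(G i a' - G j a') \<bullet> (a - a')\<bar> \<le> norm (G i a' - G j a') * norm (a - a')"
    by (rule Cauchy_Schwarz_ineq2)
  also have "\<dots> \<le> L * (\<epsilon> * dist i j) * norm (a - a')"
    using G_sensitive[OF i j a'] by (intro mult_right_mono) auto
  moreover have "(G i a - G j a') \<bullet> (a - a') = (G i a - G i a') \<bullet> (a - a') + (G i a' - G j a') \<bullet> (a - a')"
    by (simp add: inner_diff_left)
  ultimately show ?thesis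
    using G_monotone[OF i a a'] by (simp add: mult.assoc)
qed

section \<open>Existence, optimality condition and sensitivity of minimizers\<close>

lemma continuous_on_risk:
  assumes i: "i \<in> K"
  shows "continuous_on A (risk i)"
  unfolding continuous_on_def
proof
  fix a assume a: "a \<in> A"
  \<comment> \<open>The risk is squeezed between its tangent at \<open>a\<close> and that tangent
    plus a quadratic term. The upper bound is the tangent inequality based at \<open>b\<close>, with
    \<open>G i b\<close> replaced by \<open>G i a\<close> at Lipschitz cost.\<close>
  have lower: "risk i a + G i a \<bullet> (b - a) \<le> risk i b"
    and upper: "risk i b \<le> risk i a + (G i a \<bullet> (b - a) + L * (norm (b - a))\<^sup>2)" if b: "b \<in> A" for b
  proof -
    show "risk i a + G i a \<bullet> (b - a) \<le> risk i b"
      using risk_strongly_convex[OF i b a] \<gamma> by (smt (verit) zero_le_mult_iff zero_le_power2 divide_pos_pos)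
    have "risk i b + G i b \<bullet> (a - b) \<le> risk i a"
      using risk_strongly_convex[OF i a b] \<gamma> by (smt (verit) zero_le_mult_iff zero_le_power2 divide_pos_pos)
    then have "risk i b \<le> risk i a + (G i a \<bullet> (b - a) + (G i b - G i a) \<bullet> (b - a))"
      by (simp add: inner_diff_left inner_diff_right)
    also have "(G i b - G i a) \<bullet> (b - a) \<le> norm (G i b - G i a) * norm (b - a)"
      by (rule norm_cauchy_schwarz)
    also have "\<dots> \<le> L * norm (b - a) * norm (b - a)"
      using G_lipschitz[OF i b a] by (intro mult_right_mono) auto
    finally show "risk i b \<le> risk i a + (G i a \<bullet> (b - a) + L * (norm (b - a))\<^sup>2)"
      by (simp add: power2_eq_square mult.assoc)
  qed
  have l: "((\<lambda>b. risk i a + G i a \<bullet> (b - a)) \<longlongrightarrow> risk i a + G i a \<bullet> (a - a)) (at a within A)"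
    by (intro tendsto_intros)
  have u: "((\<lambda>b. risk i a + (G i a \<bullet> (b - a) + L * (norm (b - a))\<^sup>2))
      \<longlongrightarrow> risk i a + (G i a \<bullet> (a - a) + L * (norm (a - a))\<^sup>2)) (at a within A)"
    by (intro tendsto_intros)
  show "(risk i \<longlongrightarrow> risk i a) (at a within A)"
    by (rule tendsto_sandwich[OF _ _ l[simplified] u[simplified]])
      (use lower upper in \<open>auto simp: eventually_at_filter\<close>)
qed

lemma ex_minimum:
  assumes i: "i \<in> K"
  obtains a where "a \<in> A" "\<And>b. b \<in> A \<Longrightarrow> risk i a \<le> risk i b"
proof -
  obtain a0 where a0: "a0 \<in> A" using A by auto
  \<comment> \<open>Beyond this radius the quadratic term of strong convexity outweighs the linear
    term at \<open>a0\<close>, so the risk is at least \<open>risk i a0\<close> and the search can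
    be confined to a compact ball.\<close>
  define r where "r = 2 * norm (G i a0) / \<gamma>"
  let ?B = "A \<inter> cball a0 r"
  have "0 \<le> r" using \<gamma> by (simp add: r_def)
  have "compact ?B" using A by auto
  moreover have "a0 \<in> ?B" using a0 \<open>0 \<le> r\<close> by auto
  moreover have "continuous_on ?B (risk i)"
    using continuous_on_risk[OF i] continuous_on_subset by blast
  ultimately obtain a where a: "a \<in> ?B" and min: "\<And>b. b \<in> ?B \<Longrightarrow> risk i a \<le> risk i b"
    using continuous_attains_inf[of ?B "risk i"] by (metis empty_iff)
  have "risk i a \<le> risk i b" if b: "b \<in> A" for b
  proof (cases "b \<in> ?B")
    case True
    then show ?thesis by (rule min)
  next
    case False
    then have "r < norm (b - a0)" using b by (simp add: dist_norm norm_minus_commute)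
    then have far: "norm (G i a0) \<le> \<gamma> / 2 * norm (b - a0)"
      using \<gamma> by (simp add: r_def divide_simps mult.commute)
    have "- (G i a0 \<bullet> (b - a0)) \<le> norm (G i a0) * norm (b - a0)"
      by (metis inner_minus_left norm_cauchy_schwarz norm_minus_cancel)
    also have "\<dots> \<le> \<gamma> / 2 * norm (b - a0) * norm (b - a0)"
      using far by (rule mult_right_mono) simp
    finally have "risk i a0 \<le> risk i b"
      using risk_strongly_convex[OF i b a0] by (simp add: power2_eq_square)
    then show ?thesis using min[OF \<open>a0 \<in> ?B\<close>] by simp
  qed
  with a that show thesis by blast
qed

text \<open>On the segment from \<open>a\<close> to \<open>b\<close>, minimality at \<open>a\<close>
  and the tangent inequality at a nearby point \<open>c\<close> give the sign of
  \<open>G i c\<close> in the direction \<open>b - a\<close>. Returning from \<open>c\<close> to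
  \<open>a\<close> costs a term of order \<open>t\<close>, which vanishes as \<open>t\<close> tends
  to 0.\<close>

lemma first_order_condition:
  assumes i: "i \<in> K" and a: "a \<in> A" and min: "\<And>b. b \<in> A \<Longrightarrow> risk i a \<le> risk i b" and b: "b \<in> A"
  shows "0 \<le> G i a \<bullet> (b - a)"
proof -
  have *: "0 \<le> G i a \<bullet> (b - a) + L * (t * (norm (b - a))\<^sup>2)" if t: "0 < t" "t < 1" for t
  proof -
    define c where "c = a + t *\<^sub>R (b - a)"
    have "c = (1 - t) *\<^sub>R a + t *\<^sub>R b" by (simp add: c_def algebra_simps)
    then have c: "c \<in> A" using A a b t by (simp add: convexD_alt)
    have "risk i c + G i c \<bullet> (a - c) \<le> risk i a"
      using risk_strongly_convex[OF i a c] \<gamma> by (smt (verit) zero_le_mult_iff zero_le_power2 divide_pos_pos)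
    then have "0 \<le> t * (G i c \<bullet> (b - a))"
      using min[OF c] by (simp add: c_def)
    then have "0 \<le> G i c \<bullet> (b - a)" using t by (simp add: zero_le_mult_iff)
    also have "\<dots> = G i a \<bullet> (b - a) + (G i c - G i a) \<bullet> (b - a)"
      by (simp add: inner_diff_left)
    also have "(G i c - G i a) \<bullet> (b - a) \<le> norm (G i c - G i a) * norm (b - a)"
      by (rule norm_cauchy_schwarz)
    also have "\<dots> \<le> (L * (t * norm (b - a))) * norm (b - a)"
      using G_lipschitz[OF i c a] t by (intro mult_right_mono) (auto simp: c_def)
    finally show ?thesis by (simp add: power2_eq_square mult.assoc)
  qed
  have "((\<lambda>t. G i a \<bullet> (b - a) + L * (t * (norm (b - a))\<^sup>2)) \<longlongrightarrow> G i a \<bullet> (b - a) + L * (0 * (norm (b - a))\<^sup>2))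
      (at_right 0)"
    by (intro tendsto_intros)
  then have "0 \<le> G i a \<bullet> (b - a) + L * (0 * (norm (b - a))\<^sup>2)"
    by (rule tendsto_lowerbound)
      (use * in \<open>auto simp: eventually_at_right_field intro!: exI[of _ 1]\<close>)
  then show ?thesis by simp
qed

text \<open>Each minimizer is tested against the other in \<open>first_order_condition\<close>. The
  sum of the two inequalities makes the product in \<open>G_monotone_sensitive\<close> nonpositive,
  and a factor \<open>dist a b\<close> cancels.\<close>

lemma minimum_sensitive:
  assumes i: "i \<in> K" and a: "a \<in> A" and min_a: "\<And>c. c \<in> A \<Longrightarrow> risk i a \<le> risk i c"
    and j: "j \<in> K" and b: "b \<in> A" and min_b: "\<And>c. c \<in> A \<Longrightarrow> risk j b \<le> risk j c"
  shows "dist a b \<le> L * \<epsilon> / \<gamma> * dist i j"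
proof -
  have "(G i a - G j b) \<bullet> (a - b) \<le> 0"
    using first_order_condition[OF i a min_a b] first_order_condition[OF j b min_b a]
    by (simp add: inner_diff_left inner_diff_right)
  then have "\<gamma> * dist a b * dist a b \<le> L * \<epsilon> * dist i j * dist a b"
    using G_monotone_sensitive[OF i j a b] by (simp add: power2_eq_square dist_norm mult.assoc)
  then have "\<gamma> * dist a b \<le> L * \<epsilon> * dist i j"
    using L \<epsilon> by (cases "dist a b = 0") (auto dest: mult_right_le_imp_le)
  then show ?thesis
    using \<gamma> by (simp add: divide_simps mult.commute)
qed

lemma is_arg_min_minimizer:
  assumes i: "i \<in> K"
  shows "is_arg_min (risk i) (\<lambda>a. a \<in> A) (minimizer i)"
proof -
  obtain a where "a \<in> A" "\<And>b. b \<in> A \<Longrightarrow> risk i a \<le> risk i b"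
    using ex_minimum[OF i] by metis
  then have "is_arg_min (risk i) (\<lambda>a. a \<in> A) a"
    by (simp add: is_arg_min_linorder)
  then show ?thesis
    unfolding minimizer_def arg_min_def by (rule someI)
qed

lemma minimizer_in: "i \<in> K \<Longrightarrow> minimizer i \<in> A"
  using is_arg_min_minimizer by (simp add: is_arg_min_linorder)

lemma minimizer_lipschitz:
  assumes "i \<in> K" "j \<in> K"
  shows "dist (minimizer i) (minimizer j) \<le> L * \<epsilon> / \<gamma> * dist i j"
  using assms is_arg_min_minimizer by (intro minimum_sensitive) (auto simp: is_arg_min_linorder)

end

section \<open>Linear algebra and derivatives within convex sets\<close>

lemma matrix_inv_mult_vec:
  fixes A :: "real^'n::finite^'n"
  assumes "invertible A"
  shows "A *v (matrix_inv A *v x) = x" and "matrix_inv A *v (A *v x) = x"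
  using someI_ex[OF assms[unfolded invertible_def]]
  by (simp_all add: matrix_inv_def matrix_vector_mul_assoc)

lemma invertible_if_kernel_trivial:
  fixes A :: "real^'n::finite^'n"
  assumes "\<And>x. A *v x = 0 \<Longrightarrow> x = 0"
  shows "invertible A"
  using assms by (simp add: invertible_left_inverse matrix_left_invertible_ker)

lemma schur_complement_mult_vec:
  fixes A :: "real^'m::finite^'m" and B :: "real^'n::finite^'m"
    and C :: "real^'m^'n" and D :: "real^'n^'n"
  shows "(A - B ** matrix_inv D ** C) *v u = A *v u - B *v (matrix_inv D *v (C *v u))"
  by (simp add: matrix_vector_mult_diff_rdistrib matrix_vector_mul_assoc matrix_mul_assoc)

text \<open>Solving the second row for \<open>v\<close> extends a kernel vector \<open>u\<close> of
  the Schur complement to a kernel vector of the whole block matrix.\<close>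

lemma invertible_schur_complement:
  fixes A :: "real^'m::finite^'m" and B :: "real^'n::finite^'m"
    and C :: "real^'m^'n" and D :: "real^'n^'n"
  assumes D: "invertible D"
    and ker: "\<And>u v. A *v u + B *v v = 0 \<Longrightarrow> C *v u + D *v v = 0 \<Longrightarrow> u = 0"
  shows "invertible (A - B ** matrix_inv D ** C)"
proof (rule invertible_if_kernel_trivial)
  fix u assume "(A - B ** matrix_inv D ** C) *v u = 0"
  then have "A *v u + B *v (- (matrix_inv D *v (C *v u))) = 0"
    by (simp add: schur_complement_mult_vec vec.neg)
  moreover have "C *v u + D *v (- (matrix_inv D *v (C *v u))) = 0"
    by (simp add: vec.neg matrix_inv_mult_vec[OF D])
  ultimately show "u = 0" by (rule ker)
qed

text \<open>Gaussian elimination of \<open>v\<close>. It is applied to the system as it stands, with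
  \<open>z = 0\<close>, to produce \<open>Sp\<close>, and with the two models exchanged, with
  \<open>w = 0\<close>, to produce \<open>Sq\<close> and \<open>Cq\<close>.\<close>

lemma block_system_solution:
  fixes A :: "real^'m::finite^'m" and B :: "real^'n::finite^'m"
    and C :: "real^'m^'n" and D :: "real^'n^'n"
  assumes "invertible D" "invertible (A - B ** matrix_inv D ** C)"
    and "A *v u + B *v v = w" "C *v u + D *v v = z"
  shows "u = matrix_inv (A - B ** matrix_inv D ** C) *v (w - B *v (matrix_inv D *v z))"
proof -
  have "B *v (matrix_inv D *v z) = B *v (matrix_inv D *v (C *v u)) + B *v v"
    using assms(1,4) by (simp add: matrix_inv_mult_vec matrix_vector_right_distrib flip: assms(4))
  then have "(A - B ** matrix_inv D ** C) *v u = w - B *v (matrix_inv D *v z)"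
    using assms(3) by (simp add: schur_complement_mult_vec flip: assms(3))
  then show ?thesis
    using matrix_inv_mult_vec(2)[OF assms(2), of u] by simp
qed

section \<open>Derivatives within convex sets with interior points, boundary points included\<close>

lemma has_derivative_within_ray:
  fixes F :: "'a::real_normed_vector \<Rightarrow> 'b::real_normed_vector"
  assumes F: "(F has_derivative D) (at x within K)" and "convex K" "x \<in> K" and d: "x + d \<in> K"
  shows "((\<lambda>t. (F (x + t *\<^sub>R d) - F x) /\<^sub>R t) \<longlongrightarrow> D d) (at_right 0)"
proof -
  have K: "x + t *\<^sub>R d \<in> K" if "0 \<le> t" "t \<le> 1" for t
  proof -
    have "(1 - t) *\<^sub>R x + t *\<^sub>R (x + d) \<in> K"
      using assms that by (intro convexD_alt) auto
    then show ?thesis by (simp add: algebra_simps)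
  qed
  have "((\<lambda>t. x + t *\<^sub>R d) has_derivative (\<lambda>t. t *\<^sub>R d)) (at 0 within {0..1})"
    by (auto intro!: derivative_eq_intros)
  moreover have "(F has_derivative D) (at (x + 0 *\<^sub>R d) within (\<lambda>t. x + t *\<^sub>R d) ` {0..1})"
    using F K by (auto intro: has_derivative_subset)
  ultimately have "((\<lambda>t. F (x + t *\<^sub>R d)) has_derivative (\<lambda>t. D (t *\<^sub>R d))) (at 0 within {0..1})"
    by (rule has_derivative_in_compose)
  then have "((\<lambda>t. (1 / \<bar>t\<bar>) *\<^sub>R (F (x + t *\<^sub>R d) - (F x + t *\<^sub>R D d))) \<longlongrightarrow> 0) (at_right 0)"
    using F by (simp add: has_derivative_within linear_scale[OF has_derivative_linear[OF F]]
        at_within_Icc_at_right)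
  then have "((\<lambda>t. (F (x + t *\<^sub>R d) - F x) /\<^sub>R t - D d) \<longlongrightarrow> 0) (at_right 0)"
    by (rule Lim_transform_eventually)
      (auto simp: eventually_at_filter algebra_simps divide_inverse)
  then show ?thesis by (rule LIM_zero_cancel)
qed

text \<open>At a boundary point \<open>x\<close> the direction \<open>w\<close> itself may leave
  \<open>K\<close>. Aiming from \<open>x\<close> at two points of a ball inside \<open>K\<close>
  makes a positive multiple of \<open>w\<close> a difference of two feasible directions, and linear
  maps are determined on such differences.\<close>

lemma feasible_direction_differences:
  fixes x w :: "'a::real_normed_vector"
  assumes "interior K \<noteq> {}"
  obtains c s where "0 < s" "x + c \<in> K" "x + (c + s *\<^sub>R w) \<in> K"
proof -
  obtain y r where r: "0 < r" "ball y r \<subseteq> K"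
    using assms by (metis ex_in_conv mem_interior)
  \<comment> \<open>The summand 1 covers \<open>w = 0\<close>, and the factor 2 keeps
    \<open>y + s *\<^sub>R w\<close> strictly inside the ball.\<close>
  define s where "s = r / (2 * (norm w + 1))"
  have pos: "0 < norm w + 1" by (smt (verit) norm_ge_zero)
  then have s: "0 < s" using r by (simp add: s_def)
  have "s * norm w \<le> s * (norm w + 1)" using s by simp
  also have "\<dots> = r / 2" using pos by (simp add: s_def field_simps)
  finally have "norm (s *\<^sub>R w) < r" using r s by simp
  then have "y + s *\<^sub>R w \<in> K" "y \<in> K"
    using r by (auto simp: dist_norm subset_iff)
  with s show thesis
    by (intro that[of s "y - x"]) (auto simp: algebra_simps)
qed

text \<open>Both derivatives equal the limit of difference quotients along feasible rays, hence
  agree on feasible directions and, by linearity, on their differences.\<close>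

lemma has_derivative_within_convex_unique:
  fixes F :: "'a::real_normed_vector \<Rightarrow> 'b::real_normed_vector"
  assumes D: "(F has_derivative D) (at x within K)" and D': "(F has_derivative D') (at x within K)"
    and K: "convex K" "x \<in> K" "interior K \<noteq> {}"
  shows "D = D'"
proof
  fix w
  have eq: "D d = D' d" if "x + d \<in> K" for d
    using has_derivative_within_ray[OF D K(1,2) that] has_derivative_within_ray[OF D' K(1,2) that]
    by (rule tendsto_unique[rotated]) simp
  obtain c s where s: "0 < s" "x + c \<in> K" "x + (c + s *\<^sub>R w) \<in> K"
    using feasible_direction_differences[OF K(3)] .
  have "D (c + s *\<^sub>R w) - D c = D' (c + s *\<^sub>R w) - D' c"
    using eq s by simp
  then show "D w = D' w"
    using s D D' by (simp add: linear_add linear_scale has_derivative_linear)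
qed

text \<open>The two points \<open>x + t (c + s w)\<close> and \<open>x + t c\<close> both approach \<open>x\<close> from inside \<open>K\<close>, so the
  monotonicity inequality passes to the derivative in every direction \<open>w\<close>, even if \<open>x\<close> is a
  boundary point.\<close>

lemma has_derivative_within_monotone:
  fixes F :: "'a::real_normed_vector \<Rightarrow> 'b::real_inner"
  assumes F: "(F has_derivative D) (at x within K)"
    and K: "convex K" "x \<in> K" "interior K \<noteq> {}"
    and P: "linear P" and Q: "\<And>t w. Q (t *\<^sub>R w) = t\<^sup>2 * Q w"
    and mono: "\<And>a b. a \<in> K \<Longrightarrow> b \<in> K \<Longrightarrow> Q (a - b) \<le> (F a - F b) \<bullet> P (a - b)"
  shows "Q w \<le> D w \<bullet> P w"
proof -
  obtain c s where s: "0 < s" "x + c \<in> K" "x + (c + s *\<^sub>R w) \<in> K"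
    using feasible_direction_differences[OF K(3)] .
  let ?d = "c + s *\<^sub>R w"
  let ?q = "\<lambda>t. (F (x + t *\<^sub>R ?d) - F x) /\<^sub>R t - (F (x + t *\<^sub>R c) - F x) /\<^sub>R t"
  have lim: "((\<lambda>t. ?q t \<bullet> P (s *\<^sub>R w)) \<longlongrightarrow> (D ?d - D c) \<bullet> P (s *\<^sub>R w)) (at_right 0)"
    by (intro tendsto_intros has_derivative_within_ray[OF F K(1,2)] s)
  have feasible: "x + t *\<^sub>R d \<in> K" if "0 < t" "t < 1" "x + d \<in> K" for t d
  proof -
    have "(1 - t) *\<^sub>R x + t *\<^sub>R (x + d) \<in> K"
      using K that by (intro convexD_alt) auto
    then show ?thesis by (simp add: algebra_simps)
  qed
  have ge: "Q (s *\<^sub>R w) \<le> ?q t \<bullet> P (s *\<^sub>R w)" if t: "0 < t" "t < 1" for t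
  proof -
    have "Q (t *\<^sub>R (s *\<^sub>R w)) \<le> (F (x + t *\<^sub>R ?d) - F (x + t *\<^sub>R c)) \<bullet> P (t *\<^sub>R (s *\<^sub>R w))"
      using mono[OF feasible[OF t s(3)] feasible[OF t s(2)]] by (simp add: algebra_simps)
    moreover have "F (x + t *\<^sub>R ?d) - F (x + t *\<^sub>R c) = t *\<^sub>R ?q t"
      using t by (simp add: algebra_simps)
    moreover have "P (t *\<^sub>R (s *\<^sub>R w)) = t *\<^sub>R P (s *\<^sub>R w)"
      by (rule linear_scale[OF P])
    \<comment> \<open>One factor \<open>t\<close> comes from the difference of \<open>F\<close> and
      one from \<open>P\<close>, matching the degree two of \<open>Q\<close>; cancelling them leaves
      a bound that survives the limit.\<close>
    ultimately have "t\<^sup>2 * Q (s *\<^sub>R w) \<le> t\<^sup>2 * (?q t \<bullet> P (s *\<^sub>R w))"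
      by (simp only: Q inner_scaleR_left inner_scaleR_right power2_eq_square mult.assoc)
    then show ?thesis using t by simp
  qed
  have "Q (s *\<^sub>R w) \<le> (D ?d - D c) \<bullet> P (s *\<^sub>R w)"
    by (rule tendsto_lowerbound[OF lim])
      (use ge in \<open>auto simp: eventually_at_right_field intro!: exI[of _ 1]\<close>)
  moreover have "D ?d - D c = s *\<^sub>R D w"
    using F by (simp add: linear_add linear_scale has_derivative_linear)
  ultimately have "s\<^sup>2 * Q w \<le> s\<^sup>2 * (D w \<bullet> P w)"
    by (simp add: Q linear_scale[OF P] power2_eq_square mult.assoc)
  then show ?thesis using s by simp
qed

text \<open>\<open>jacobian\<close> is built from a chosen derivative; an interior point of
  \<open>K\<close> makes the choice unique, so any known derivative \<open>D\<close> computes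
  it.\<close>

lemma jacobian_mult_vec_within_convex:
  fixes F :: "real^'m::finite \<Rightarrow> real^'n::finite"
  assumes F: "(F has_derivative D) (at x within K)" and K: "convex K" "x \<in> K" "interior K \<noteq> {}"
  shows "jacobian F (at x within K) *v u = D u"
proof -
  have "F differentiable (at x within K)"
    using F by (auto simp: differentiable_def)
  then have "(F has_derivative (\<lambda>u. jacobian F (at x within K) *v u)) (at x within K)"
    by (simp add: jacobian_works)
  from has_derivative_within_convex_unique[OF this F K] show ?thesis by metis
qed

section \<open>Contraction of the retraining schedules\<close>

text \<open>Here \<open>n\<close> is the old joint displacement, \<open>x\<close> the new
  displacement of the coordinate updated first, and \<open>y\<close> that of the coordinate updated
  second, which already sees \<open>x\<close>.\<close>

lemma Gauss_Seidel_estimate: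
  fixes x y n \<alpha> \<beta> :: real
  assumes "0 \<le> x" "0 \<le> y" "0 \<le> n" "0 \<le> \<alpha>" "0 \<le> \<beta>" "\<alpha> + \<beta> \<le> 1"
    and x: "x \<le> \<alpha> * n" and y: "y \<le> \<beta> * sqrt (x\<^sup>2 + n\<^sup>2)"
  shows "sqrt (x\<^sup>2 + y\<^sup>2) \<le> (\<alpha> + \<beta>) * n"
proof -
  have x2: "x\<^sup>2 \<le> \<alpha>\<^sup>2 * n\<^sup>2"
    using power_mono[OF x \<open>0 \<le> x\<close>, of 2] by (simp add: power_mult_distrib)
  have "y\<^sup>2 \<le> \<beta>\<^sup>2 * (x\<^sup>2 + n\<^sup>2)"
    using power_mono[OF y \<open>0 \<le> y\<close>, of 2] by (simp add: power_mult_distrib)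
  also have "\<dots> \<le> \<beta>\<^sup>2 * (\<alpha>\<^sup>2 * n\<^sup>2 + n\<^sup>2)"
    using x2 by (intro mult_left_mono) auto
  finally have "x\<^sup>2 + y\<^sup>2 \<le> (\<alpha>\<^sup>2 + \<beta>\<^sup>2 + (\<alpha> * \<beta>) * (\<alpha> * \<beta>)) * n\<^sup>2"
    using x2 by (simp add: algebra_simps power2_eq_square)
  also have "\<dots> \<le> (\<alpha> + \<beta>)\<^sup>2 * n\<^sup>2"
  proof (rule mult_right_mono)
    have "\<alpha> * \<beta> \<le> 1 * 1"
      using assms by (intro mult_mono) auto
    \<comment> \<open>The cross term \<open>2 * \<alpha> * \<beta>\<close> of the square absorbs the
      product term caused by sequential updating.\<close>
    then have "(\<alpha> * \<beta>) * (\<alpha> * \<beta>) \<le> (\<alpha> * \<beta>) * 2"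
      using assms by (intro mult_left_mono) auto
    then show "\<alpha>\<^sup>2 + \<beta>\<^sup>2 + (\<alpha> * \<beta>) * (\<alpha> * \<beta>) \<le> (\<alpha> + \<beta>)\<^sup>2"
      by (simp add: power2_sum)
  qed simp
  finally have "x\<^sup>2 + y\<^sup>2 \<le> ((\<alpha> + \<beta>) * n)\<^sup>2"
    by (simp add: power_mult_distrib)
  then show ?thesis
    using assms by (intro real_le_lsqrt) auto
qed

lemma contraction_iterates_tendsto:
  fixes f :: "'a::metric_space \<Rightarrow> 'a"
  assumes f: "\<And>z. z \<in> K \<Longrightarrow> f z \<in> K" and z: "z \<in> K" and x: "x \<in> K" "f x = x"
    and c: "0 \<le> c" "c < 1" and lip: "\<And>z w. z \<in> K \<Longrightarrow> w \<in> K \<Longrightarrow> dist (f z) (f w) \<le> c * dist z w"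
  shows "(\<lambda>t. (f ^^ t) z) \<longlonglongrightarrow> x"
proof -
  have *: "(f ^^ t) z \<in> K \<and> dist ((f ^^ t) z) x \<le> c ^ t * dist z x" for t
  proof (induction t)
    case (Suc t)
    have "dist (f ((f ^^ t) z)) (f x) \<le> c * dist ((f ^^ t) z) x"
      using lip Suc x by blast
    also have "\<dots> \<le> c * (c ^ t * dist z x)"
      using Suc c by (intro mult_left_mono) auto
    finally show ?case using f Suc x by (simp add: mult.assoc)
  qed (use z in simp)
  have "(\<lambda>t. c ^ t * dist z x) \<longlonglongrightarrow> 0"
    using tendsto_mult_left_zero[OF LIMSEQ_realpow_zero[OF c]] by simp
  then show ?thesis
    unfolding tendsto_dist_iff[of _ x] by (rule Lim_null_comparison[rotated]) (simp add: *)
qed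

locale coupled_updates =
  fixes A :: "'a::complete_space set" and B :: "'b::complete_space set"
    and T\<^sub>1 :: "'a \<times> 'b \<Rightarrow> 'a" and T\<^sub>2 :: "'a \<times> 'b \<Rightarrow> 'b" and \<alpha> \<beta> :: real
  assumes T\<^sub>1_in: "\<And>z. z \<in> A \<times> B \<Longrightarrow> T\<^sub>1 z \<in> A" and T\<^sub>2_in: "\<And>z. z \<in> A \<times> B \<Longrightarrow> T\<^sub>2 z \<in> B"
    and nonneg: "0 \<le> \<alpha>" "0 \<le> \<beta>" and less_1: "\<alpha> + \<beta> < 1"
    and T\<^sub>1_lipschitz: "\<And>z w. z \<in> A \<times> B \<Longrightarrow> w \<in> A \<times> B \<Longrightarrow> dist (T\<^sub>1 z) (T\<^sub>1 w) \<le> \<alpha> * dist z w"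
    and T\<^sub>2_lipschitz: "\<And>z w. z \<in> A \<times> B \<Longrightarrow> w \<in> A \<times> B \<Longrightarrow> dist (T\<^sub>2 z) (T\<^sub>2 w) \<le> \<beta> * dist z w"
begin

lemma simultaneous_contraction:
  assumes z: "z \<in> A \<times> B" and w: "w \<in> A \<times> B"
  shows "dist (T\<^sub>1 z, T\<^sub>2 z) (T\<^sub>1 w, T\<^sub>2 w) \<le> (\<alpha> + \<beta>) * dist z w"
  unfolding dist_Pair_Pair
proof (rule Gauss_Seidel_estimate)
  \<comment> \<open>Weakening the simultaneous bound to the sequential form lets the same estimate
    serve this schedule.\<close>
  have "dist z w \<le> sqrt ((dist (T\<^sub>1 z) (T\<^sub>1 w))\<^sup>2 + (dist z w)\<^sup>2)"
    by (intro real_le_rsqrt) simp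
  then have "\<beta> * dist z w \<le> \<beta> * sqrt ((dist (T\<^sub>1 z) (T\<^sub>1 w))\<^sup>2 + (dist z w)\<^sup>2)"
    using nonneg by (intro mult_left_mono)
  then show "dist (T\<^sub>2 z) (T\<^sub>2 w) \<le> \<beta> * sqrt ((dist (T\<^sub>1 z) (T\<^sub>1 w))\<^sup>2 + (dist z w)\<^sup>2)"
    using T\<^sub>2_lipschitz[OF z w] by simp
qed (use nonneg less_1 T\<^sub>1_lipschitz[OF z w] in auto)

lemma first_then_second_contraction:
  assumes z: "z \<in> A \<times> B" and w: "w \<in> A \<times> B"
  shows "dist (T\<^sub>1 z, T\<^sub>2 (T\<^sub>1 z, snd z)) (T\<^sub>1 w, T\<^sub>2 (T\<^sub>1 w, snd w)) \<le> (\<alpha> + \<beta>) * dist z w"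
  unfolding dist_Pair_Pair
proof (rule Gauss_Seidel_estimate)
  have "dist (T\<^sub>2 (T\<^sub>1 z, snd z)) (T\<^sub>2 (T\<^sub>1 w, snd w)) \<le> \<beta> * dist (T\<^sub>1 z, snd z) (T\<^sub>1 w, snd w)"
    using z w T\<^sub>1_in by (intro T\<^sub>2_lipschitz) auto
  also have "\<dots> \<le> \<beta> * sqrt ((dist (T\<^sub>1 z) (T\<^sub>1 w))\<^sup>2 + (dist z w)\<^sup>2)"
    unfolding dist_Pair_Pair
    using nonneg by (intro mult_left_mono real_sqrt_le_mono add_left_mono power_mono dist_snd_le) auto
  finally show "dist (T\<^sub>2 (T\<^sub>1 z, snd z)) (T\<^sub>2 (T\<^sub>1 w, snd w))
      \<le> \<beta> * sqrt ((dist (T\<^sub>1 z) (T\<^sub>1 w))\<^sup>2 + (dist z w)\<^sup>2)" .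
qed (use nonneg less_1 T\<^sub>1_lipschitz[OF z w] in auto)

lemma second_then_first_contraction:
  assumes z: "z \<in> A \<times> B" and w: "w \<in> A \<times> B"
  shows "dist (T\<^sub>1 (fst z, T\<^sub>2 z), T\<^sub>2 z) (T\<^sub>1 (fst w, T\<^sub>2 w), T\<^sub>2 w) \<le> (\<alpha> + \<beta>) * dist z w"
  \<comment> \<open>The second coordinate moves first here, so squares and constants are swapped to
    fit the order of \<open>Gauss_Seidel_estimate\<close>.\<close>
  unfolding dist_Pair_Pair add.commute[of "(dist (T\<^sub>1 _) _)\<^sup>2"] add.commute[of \<alpha>]
proof (rule Gauss_Seidel_estimate)
  have "dist (T\<^sub>1 (fst z, T\<^sub>2 z)) (T\<^sub>1 (fst w, T\<^sub>2 w)) \<le> \<alpha> * dist (fst z, T\<^sub>2 z) (fst w, T\<^sub>2 w)"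
    using z w T\<^sub>2_in by (intro T\<^sub>1_lipschitz) auto
  also have "\<dots> \<le> \<alpha> * sqrt ((dist z w)\<^sup>2 + (dist (T\<^sub>2 z) (T\<^sub>2 w))\<^sup>2)"
    unfolding dist_Pair_Pair
    using nonneg by (intro mult_left_mono real_sqrt_le_mono add_right_mono power_mono dist_fst_le) auto
  finally show "dist (T\<^sub>1 (fst z, T\<^sub>2 z)) (T\<^sub>1 (fst w, T\<^sub>2 w))
      \<le> \<alpha> * sqrt ((dist (T\<^sub>2 z) (T\<^sub>2 w))\<^sup>2 + (dist z w)\<^sup>2)" by (simp add: add.commute)
qed (use nonneg less_1 T\<^sub>2_lipschitz[OF z w] in auto)

text \<open>Banach's theorem for the simultaneous update. Its fixed point is fixed by each
  coordinate map, hence by the two sequential updates as well.\<close>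

lemma ex_common_fixpoint:
  assumes "closed A" "closed B" "A \<noteq> {}" "B \<noteq> {}"
  obtains a b where "a \<in> A" "b \<in> B" "T\<^sub>1 (a, b) = a" "T\<^sub>2 (a, b) = b"
proof -
  have "\<exists>!z\<in>A \<times> B. (T\<^sub>1 z, T\<^sub>2 z) = z"
  proof (rule Banach_fix[where c = "\<alpha> + \<beta>"])
    show "dist (T\<^sub>1 z, T\<^sub>2 z) (T\<^sub>1 w, T\<^sub>2 w) \<le> (\<alpha> + \<beta>) * dist z w"
      if "z \<in> A \<times> B" "w \<in> A \<times> B" for z w
      using that by (rule simultaneous_contraction)
  qed (use assms nonneg less_1 T\<^sub>1_in T\<^sub>2_in in
      \<open>auto simp: complete_eq_closed closed_Times\<close>)
  then obtain z where "z \<in> A \<times> B" "(T\<^sub>1 z, T\<^sub>2 z) = z"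
    by blast
  then show thesis
    using that[of "fst z" "snd z"] by (cases z) simp
qed

end

section \<open>The two-model system\<close>

text \<open>The infinitesimal form of \<open>G_monotone_sensitive\<close>. The index moves the
  distribution and, through the projection \<open>P\<close>, also the decision at which the gradient
  is evaluated; \<open>P\<close> will be \<open>fst\<close> for model \<theta> and
  \<open>snd\<close> for model \<phi>.\<close>

lemma decision_dependent_gradient_derivative:
  fixes K :: "'i::real_normed_vector set"
  assumes "decision_dependent_risk A l g K D \<gamma> L \<epsilon>"
    and P: "linear P" "\<And>i. i \<in> K \<Longrightarrow> P i \<in> A"
    and F: "((\<lambda>i. \<integral>z. g (P i) z \<partial>D i) has_derivative F') (at x within K)"
    and K: "convex K" "x \<in> K" "interior K \<noteq> {}"
    and "F' w \<bullet> P w = 0"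
  shows "norm (P w) \<le> L * \<epsilon> / \<gamma> * norm w"
proof -
  interpret decision_dependent_risk A l g K D \<gamma> L \<epsilon> by fact
  have "\<gamma> * (norm (P w))\<^sup>2 - L * \<epsilon> * norm w * norm (P w) \<le> F' w \<bullet> P w"
  proof (rule has_derivative_within_monotone[OF F K P(1)])
    show "\<gamma> * (norm (P (t *\<^sub>R w)))\<^sup>2 - L * \<epsilon> * norm (t *\<^sub>R w) * norm (P (t *\<^sub>R w))
        = t\<^sup>2 * (\<gamma> * (norm (P w))\<^sup>2 - L * \<epsilon> * norm w * norm (P w))" for t w
      by (simp add: linear_scale[OF P(1)] power_mult_distrib algebra_simps)
        (simp add: power2_eq_square flip: abs_mult)
    show "\<gamma> * (norm (P (i - j)))\<^sup>2 - L * \<epsilon> * norm (i - j) * norm (P (i - j))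
        \<le> ((\<integral>z. g (P i) z \<partial>D i) - (\<integral>z. g (P j) z \<partial>D j)) \<bullet> P (i - j)" if "i \<in> K" "j \<in> K" for i j
      using G_monotone_sensitive[OF that P(2)[OF that(1)] P(2)[OF that(2)]]
      by (simp add: G_def dist_norm linear_diff[OF P(1)])
  qed
  then have "\<gamma> * norm (P w) * norm (P w) \<le> L * \<epsilon> * norm w * norm (P w)"
    using assms(8) by (simp add: power2_eq_square mult.assoc)
  then have "\<gamma> * norm (P w) \<le> L * \<epsilon> * norm w"
    using L \<epsilon> by (cases "norm (P w) = 0") (auto dest: mult_right_le_imp_le)
  then show ?thesis
    using \<gamma> by (simp add: divide_simps mult.commute)
qed

locale self_consuming_system =
  fixes S :: "('m::finite, 'n::finite, 'x::{real_normed_vector, second_countable_topology},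
               'y::{real_normed_vector, second_countable_topology}) system"
    and I :: "real set"
    and \<gamma>\<theta> L\<theta> \<epsilon>\<theta> \<gamma>\<phi> L\<phi> \<epsilon>\<phi> :: real
  assumes admissible: "admissible S I"
    and pos: "\<gamma>\<theta> > 0" "L\<theta> \<ge> 0" "\<epsilon>\<theta> \<ge> 0" "\<gamma>\<phi> > 0" "L\<phi> \<ge> 0" "\<epsilon>\<phi> \<ge> 0"
    and convex_p: "strongly_convex_loss \<gamma>\<theta> (Theta S) (loss_p S) (grad_p S)"
    and smooth_p: "smooth_loss L\<theta> (Theta S) (grad_p S)"
    and convex_q: "strongly_convex_loss \<gamma>\<phi> (Phi S) (loss_q S) (grad_q S)"
    and smooth_q: "smooth_loss L\<phi> (Phi S) (grad_q S)"
    and sensitive_p: "\<forall>h\<in>I. sensitive \<epsilon>\<theta> (Theta S) (Phi S) (train_p S h)"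
    and sensitive_q: "sensitive \<epsilon>\<phi> (Theta S) (Phi S) (train_q S)"
    and kappa: "kappa \<gamma>\<theta> L\<theta> \<epsilon>\<theta> \<gamma>\<phi> L\<phi> \<epsilon>\<phi> < 1"
begin

section \<open>Contraction constants and the contents of admissibility\<close>

abbreviation "\<alpha> \<equiv> L\<theta> * \<epsilon>\<theta> / \<gamma>\<theta>"
abbreviation "\<beta> \<equiv> L\<phi> * \<epsilon>\<phi> / \<gamma>\<phi>"

text \<open>The sum \<open>\<alpha> + \<beta>\<close> is the third entry of the maximum defining
  \<open>kappa\<close>.\<close>

lemma contraction_factor: "0 \<le> \<alpha>" "0 \<le> \<beta>" "\<alpha> + \<beta> < 1"
  using kappa pos by (auto simp: kappa_def)

lemma parameter_sets:
  "Theta S \<noteq> {}" "closed (Theta S)" "convex (Theta S)" "Phi S \<noteq> {}" "closed (Phi S)" "convex (Phi S)"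
  by (insert admissible, unfold admissible_def) (elim conjE, assumption)+

lemma sets_real: "sets (real_p S) = sets borel" "sets (real_q S) = sets borel"
proof -
  have "borel_prob (real_p S)" "borel_prob (real_q S)"
    by (insert admissible, unfold admissible_def) (elim conjE, assumption)+
  then show "sets (real_p S) = sets borel" "sets (real_q S) = sets borel"
    by (simp_all add: borel_prob_def)
qed

lemma sets_syn_cur:
  "sets (syn_p S \<theta> \<phi>) = sets borel" "sets (cur_p S \<theta> \<phi>) = sets borel"
  "sets (syn_q S \<theta> \<phi>) = sets borel" "sets (cur_q S \<theta> \<phi>) = sets borel"
  unfolding syn_p_def cur_p_def syn_q_def cur_q_def by (rule sets_mixture)+

lemma integrable_p:
  assumes "\<theta> \<in> Theta S" "\<phi> \<in> Phi S" "\<theta>' \<in> Theta S" "M \<in> {real_p S, syn_p S \<theta> \<phi>, cur_p S \<theta> \<phi>}"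
  shows "integrable M (loss_p S \<theta>')" "integrable M (grad_p S \<theta>')"
proof -
  have "\<forall>\<theta>\<in>Theta S. \<forall>\<phi>\<in>Phi S. \<forall>\<theta>'\<in>Theta S. \<forall>M\<in>{real_p S, syn_p S \<theta> \<phi>, cur_p S \<theta> \<phi>}.
      integrable M (loss_p S \<theta>') \<and> integrable M (grad_p S \<theta>')"
    using admissible unfolding admissible_def by (elim conjE) assumption
  with assms show "integrable M (loss_p S \<theta>')" "integrable M (grad_p S \<theta>')"
    by blast+
qed

lemma integrable_q:
  assumes "\<theta> \<in> Theta S" "\<phi> \<in> Phi S" "\<phi>' \<in> Phi S" "M \<in> {real_q S, syn_q S \<theta> \<phi>, cur_q S \<theta> \<phi>}"
  shows "integrable M (loss_q S \<phi>')" "integrable M (grad_q S \<phi>')"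
proof -
  have "\<forall>\<theta>\<in>Theta S. \<forall>\<phi>\<in>Phi S. \<forall>\<phi>'\<in>Phi S. \<forall>M\<in>{real_q S, syn_q S \<theta> \<phi>, cur_q S \<theta> \<phi>}.
      integrable M (loss_q S \<phi>') \<and> integrable M (grad_q S \<phi>')"
    using admissible unfolding admissible_def by (elim conjE) assumption
  with assms show "integrable M (loss_q S \<phi>')" "integrable M (grad_q S \<phi>')"
    by blast+
qed

lemma weights_q: "0 \<le> weight_q_real S" "0 \<le> weight_q_syn S" "0 \<le> weight_q_cur S"
  by (insert admissible, unfold admissible_def) (elim conjE, assumption)+

lemma weight_ratio:
  assumes "h \<in> I" "k \<in> I"
  shows "weight_p_syn S h * weight_p_real S k = weight_p_syn S k * weight_p_real S h"
proof -
  have "\<forall>h\<in>I. \<forall>k\<in>I. weight_p_syn S h * weight_p_real S k = weight_p_syn S k * weight_p_real S h"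
    using admissible unfolding admissible_def by (elim conjE) assumption
  with assms show ?thesis by blast
qed

lemma weights:
  assumes "h \<in> I"
  shows "0 \<le> h" "h < 1" "0 \<le> weight_p_real S h" "0 \<le> weight_p_syn S h"
    "weight_p_real S h + weight_p_syn S h = 1 - h"
proof -
  have "\<forall>h\<in>I. weight_p_real S h \<ge> 0 \<and> weight_p_syn S h \<ge> 0 \<and>
      weight_p_real S h + weight_p_syn S h + h = 1" and "I \<subseteq> {0..<1}"
    by (insert admissible, unfold admissible_def) (elim conjE, assumption)+
  with assms show "0 \<le> h" "h < 1" "0 \<le> weight_p_real S h" "0 \<le> weight_p_syn S h"
    "weight_p_real S h + weight_p_syn S h = 1 - h"
    by fastforce+
qed

lemma integral_train_p:
  fixes f :: "'x \<times> 'y \<Rightarrow> 'b::euclidean_space"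
  assumes h: "h \<in> I"
    and f: "integrable (real_p S) f" "integrable (syn_p S \<theta> \<phi>) f" "integrable (cur_p S \<theta> \<phi>) f"
  shows "integrable (train_p S h \<theta> \<phi>) f"
    and "(\<integral>z. f z \<partial>train_p S h \<theta> \<phi>) = weight_p_real S h *\<^sub>R (\<integral>z. f z \<partial>real_p S)
      + weight_p_syn S h *\<^sub>R (\<integral>z. f z \<partial>syn_p S \<theta> \<phi>) + h *\<^sub>R (\<integral>z. f z \<partial>cur_p S \<theta> \<phi>)"
proof -
  let ?ws = "[(weight_p_real S h, real_p S), (weight_p_syn S h, syn_p S \<theta> \<phi>), (h, cur_p S \<theta> \<phi>)]"
  have b: "f \<in> borel_measurable borel"
    using borel_measurable_integrable[OF f(1)] by (simp add: measurable_cong_sets[OF sets_real(1) refl])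
  have ws: "0 \<le> w \<and> sets M = sets borel \<and> integrable M f" if "(w, M) \<in> set ?ws" for w M
  proof -
    have "w = weight_p_real S h \<and> M = real_p S \<or> w = weight_p_syn S h \<and> M = syn_p S \<theta> \<phi>
        \<or> w = h \<and> M = cur_p S \<theta> \<phi>"
      using that by simp
    then show ?thesis
      by (elim disjE conjE; simp only: weights(1-4)[OF h] f sets_real sets_syn_cur simp_thms)
  qed
  show "integrable (train_p S h \<theta> \<phi>) f"
    unfolding train_p_def by (rule integral_mixture(1)[OF ws b])
  show "(\<integral>z. f z \<partial>train_p S h \<theta> \<phi>) = weight_p_real S h *\<^sub>R (\<integral>z. f z \<partial>real_p S)
      + weight_p_syn S h *\<^sub>R (\<integral>z. f z \<partial>syn_p S \<theta> \<phi>) + h *\<^sub>R (\<integral>z. f z \<partial>cur_p S \<theta> \<phi>)"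
    unfolding train_p_def by (subst integral_mixture(2)[OF ws b]) (auto simp: add.assoc)
qed

lemma integrable_train_q:
  fixes f :: "'x \<times> 'y \<Rightarrow> 'b::euclidean_space"
  assumes f: "integrable (real_q S) f" "integrable (syn_q S \<theta> \<phi>) f" "integrable (cur_q S \<theta> \<phi>) f"
  shows "integrable (train_q S \<theta> \<phi>) f"
proof -
  have b: "f \<in> borel_measurable borel"
    using borel_measurable_integrable[OF f(1)] by (simp add: measurable_cong_sets[OF sets_real(2) refl])
  let ?ws = "[(weight_q_real S, real_q S), (weight_q_syn S, syn_q S \<theta> \<phi>), (weight_q_cur S, cur_q S \<theta> \<phi>)]"
  have "0 \<le> w \<and> sets M = sets borel \<and> integrable M f" if "(w, M) \<in> set ?ws" for w M
  proof -
    have "w = weight_q_real S \<and> M = real_q S \<or> w = weight_q_syn S \<and> M = syn_q S \<theta> \<phi>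
        \<or> w = weight_q_cur S \<and> M = cur_q S \<theta> \<phi>"
      using that by simp
    then show ?thesis
      by (elim disjE conjE; simp only: weights_q f sets_real sets_syn_cur simp_thms)
  qed
  then show ?thesis
    unfolding train_q_def by (rule integral_mixture(1)[OF _ b])
qed

section \<open>Retraining as decision-dependent risk minimization, and its convergence\<close>

lemma risk_p_axioms:
  assumes h: "h \<in> I"
  shows "decision_dependent_risk (Theta S) (loss_p S) (grad_p S) (Theta S \<times> Phi S)
    (\<lambda>i. train_p S h (fst i) (snd i)) \<gamma>\<theta> L\<theta> \<epsilon>\<theta>"
proof
  show "integrable (train_p S h (fst i) (snd i)) (loss_p S \<theta>)"
    "integrable (train_p S h (fst i) (snd i)) (grad_p S \<theta>)"
    if "i \<in> Theta S \<times> Phi S" "\<theta> \<in> Theta S" for i \<theta>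
    by (insert that) (rule integral_train_p(1)[OF h]; rule integrable_p[of "fst i" "snd i"]; auto)+
  show "wasserstein1 (train_p S h (fst i) (snd i)) (train_p S h (fst j) (snd j)) \<le> ennreal (\<epsilon>\<theta> * dist i j)"
    if "i \<in> Theta S \<times> Phi S" "j \<in> Theta S \<times> Phi S" for i j
    using sensitive_p h that by (auto simp: sensitive_def dist_norm)
qed (use parameter_sets pos convex_p smooth_p in auto)

lemma risk_q_axioms:
  "decision_dependent_risk (Phi S) (loss_q S) (grad_q S) (Theta S \<times> Phi S)
    (\<lambda>i. train_q S (fst i) (snd i)) \<gamma>\<phi> L\<phi> \<epsilon>\<phi>"
proof
  show "integrable (train_q S (fst i) (snd i)) (loss_q S \<phi>)"
    "integrable (train_q S (fst i) (snd i)) (grad_q S \<phi>)"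
    if "i \<in> Theta S \<times> Phi S" "\<phi> \<in> Phi S" for i \<phi>
    by (insert that) (rule integrable_train_q; rule integrable_q[of "fst i" "snd i"]; auto)+
  show "wasserstein1 (train_q S (fst i) (snd i)) (train_q S (fst j) (snd j)) \<le> ennreal (\<epsilon>\<phi> * dist i j)"
    if "i \<in> Theta S \<times> Phi S" "j \<in> Theta S \<times> Phi S" for i j
    using sensitive_q that by (auto simp: sensitive_def dist_norm)
qed (use parameter_sets pos convex_q smooth_q in auto)

text \<open>At a common fixed point of the two retraining maps the deployed pair minimizes the risks
  it induces, which is stability. Every schedule fixes this point and contracts, so all of them
  converge to it from any start.\<close>

lemma ex_stable_point:
  assumes h: "h \<in> I"
  shows "\<exists>\<theta> \<phi>. stable_point S h \<theta> \<phi> \<and> converges_to S h \<theta> \<phi>"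
proof -
  interpret P: decision_dependent_risk "Theta S" "loss_p S" "grad_p S" "Theta S \<times> Phi S"
    "\<lambda>i. train_p S h (fst i) (snd i)" \<gamma>\<theta> L\<theta> \<epsilon>\<theta>
    by (rule risk_p_axioms[OF h])
  interpret Q: decision_dependent_risk "Phi S" "loss_q S" "grad_q S" "Theta S \<times> Phi S"
    "\<lambda>i. train_q S (fst i) (snd i)" \<gamma>\<phi> L\<phi> \<epsilon>\<phi>
    by (rule risk_q_axioms)
  have risk: "P.risk (\<theta>, \<phi>) = risk_p S h \<theta> \<phi>" "Q.risk (\<theta>, \<phi>) = risk_q S \<theta> \<phi>" for \<theta> \<phi>
    by (auto simp: P.risk_def Q.risk_def risk_p_def risk_q_def fun_eq_iff)
  have retrain: "retrain_p S h \<theta> \<phi> = P.minimizer (\<theta>, \<phi>)" "retrain_q S \<theta> \<phi> = Q.minimizer (\<theta>, \<phi>)" for \<theta> \<phi>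
    by (simp_all add: retrain_p_def retrain_q_def P.minimizer_def Q.minimizer_def risk)
  interpret coupled_updates "Theta S" "Phi S" P.minimizer Q.minimizer \<alpha> \<beta>
    by (rule coupled_updates.intro) (fact contraction_factor P.minimizer_in Q.minimizer_in
        P.minimizer_lipschitz Q.minimizer_lipschitz)+
  obtain \<theta> \<phi> where in_sets: "\<theta> \<in> Theta S" "\<phi> \<in> Phi S"
    and fixpoint: "P.minimizer (\<theta>, \<phi>) = \<theta>" "Q.minimizer (\<theta>, \<phi>) = \<phi>"
    using ex_common_fixpoint[OF P.A(2) Q.A(2) P.A(1) Q.A(1)] .
  have "stable_point S h \<theta> \<phi>"
    using P.is_arg_min_minimizer[of "(\<theta>, \<phi>)"] Q.is_arg_min_minimizer[of "(\<theta>, \<phi>)"] in_sets fixpoint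
    by (simp add: stable_point_def risk)
  moreover have "converges_to S h \<theta> \<phi>"
    unfolding converges_to_def
  proof (intro allI ballI)
    fix s z assume z: "z \<in> Theta S \<times> Phi S"
    have sync: "retrain_round S h Synchronous = (\<lambda>z. (P.minimizer z, Q.minimizer z))"
      and first: "retrain_round S h Theta_First = (\<lambda>z. (P.minimizer z, Q.minimizer (P.minimizer z, snd z)))"
      and second: "retrain_round S h Phi_First = (\<lambda>z. (P.minimizer (fst z, Q.minimizer z), Q.minimizer z))"
      by (auto simp: fun_eq_iff retrain Let_def)
    show "(\<lambda>t. (retrain_round S h s ^^ t) z) \<longlonglongrightarrow> (\<theta>, \<phi>)"
    proof (rule contraction_iterates_tendsto[OF _ z, where c = "\<alpha> + \<beta>"])
      show "retrain_round S h s w \<in> Theta S \<times> Phi S" if "w \<in> Theta S \<times> Phi S" for w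
        using that by (cases s) (auto simp: sync first second intro!: T\<^sub>1_in T\<^sub>2_in)
      show "retrain_round S h s (\<theta>, \<phi>) = (\<theta>, \<phi>)"
        by (cases s) (simp_all add: retrain fixpoint Let_def)
      show "dist (retrain_round S h s v) (retrain_round S h s w) \<le> (\<alpha> + \<beta>) * dist v w"
        if "v \<in> Theta S \<times> Phi S" "w \<in> Theta S \<times> Phi S" for v w
        using simultaneous_contraction[OF that] first_then_second_contraction[OF that]
          second_then_first_contraction[OF that]
        by (cases s) (simp_all only: sync first second)
    qed (use in_sets contraction_factor in auto)
  qed
  ultimately show ?thesis by blast
qed

text \<open>The cross-multiplied ratio condition says that \<open>weight_p_real h\<close> and \<open>weight_p_syn h\<close> are both
  proportional to \<open>1 - h\<close>; so, up to that factor, only the curated part of \<open>Fp\<close> depends on \<open>h\<close>.\<close>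

lemma Fp_weight_change:
  assumes h: "h \<in> I" and k: "k \<in> I" and \<theta>: "\<theta> \<in> Theta S" and \<phi>: "\<phi> \<in> Phi S" and 0: "Fp S \<theta> \<phi> h = 0"
  shows "Fp S \<theta> \<phi> k = ((k - h) / (1 - h)) *\<^sub>R (\<integral>z. grad_p S \<theta> z \<partial>cur_p S \<theta> \<phi>)"
proof -
  define A B C where "A = (\<integral>z. grad_p S \<theta> z \<partial>real_p S)" and "B = (\<integral>z. grad_p S \<theta> z \<partial>syn_p S \<theta> \<phi>)"
    and "C = (\<integral>z. grad_p S \<theta> z \<partial>cur_p S \<theta> \<phi>)"
  have Fp: "Fp S \<theta> \<phi> j = weight_p_real S j *\<^sub>R A + weight_p_syn S j *\<^sub>R B + j *\<^sub>R C" if "j \<in> I" for j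
    unfolding Fp_def A_def B_def C_def
    using \<theta> \<phi> by (intro integral_train_p(2)[OF that] integrable_p(2)[OF \<theta> \<phi> \<theta>]) auto
  note ratio = weight_ratio[OF h k]
  note wh = weights[OF h] and wk = weights[OF k]
  have syn: "(1 - h) * weight_p_syn S k = (1 - k) * weight_p_syn S h"
    unfolding wh(5)[symmetric] wk(5)[symmetric] using ratio by (simp add: algebra_simps)
  have re: "(1 - h) * weight_p_real S k = (1 - k) * weight_p_real S h"
    unfolding wh(5)[symmetric] wk(5)[symmetric] using ratio by (simp add: algebra_simps)
  have "(1 - h) *\<^sub>R Fp S \<theta> \<phi> k
      = ((1 - h) * weight_p_real S k) *\<^sub>R A + ((1 - h) * weight_p_syn S k) *\<^sub>R B + ((1 - h) * k) *\<^sub>R C"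
    by (simp add: Fp[OF k] scaleR_add_right)
  also have "\<dots> = (1 - k) *\<^sub>R Fp S \<theta> \<phi> h + (k - h) *\<^sub>R C"
    unfolding syn re by (simp add: Fp[OF h] algebra_simps)
  finally have "(1 - h) *\<^sub>R Fp S \<theta> \<phi> k = (k - h) *\<^sub>R C"
    by (simp add: 0)
  then have "(1 / (1 - h)) *\<^sub>R ((1 - h) *\<^sub>R Fp S \<theta> \<phi> k) = (1 / (1 - h)) *\<^sub>R ((k - h) *\<^sub>R C)"
    by simp
  then show ?thesis
    using wh(2) by (simp add: C_def)
qed

section \<open>Invertible Jacobians and the linear response at a point of the parameter sets\<close>

context
  fixes \<theta> \<phi> h Ep Eq
  assumes h: "h \<in> I" and \<theta>: "\<theta> \<in> Theta S" and \<phi>: "\<phi> \<in> Phi S"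
    and interior: "interior (Theta S) \<noteq> {}" "interior (Phi S) \<noteq> {}"
    and Ep: "((\<lambda>i. Fp S (fst i) (snd i) h) has_derivative Ep) (at (\<theta>, \<phi>) within Theta S \<times> Phi S)"
    and Eq: "((\<lambda>i. Fq S (fst i) (snd i)) has_derivative Eq) (at (\<theta>, \<phi>) within Theta S \<times> Phi S)"
begin

lemma partial_derivatives:
  fixes F :: "(real^'m) \<times> (real^'n) \<Rightarrow> 'b::real_normed_vector"
  assumes "(F has_derivative E) (at (\<theta>, \<phi>) within Theta S \<times> Phi S)"
  shows "((\<lambda>\<theta>'. F (\<theta>', \<phi>)) has_derivative (\<lambda>u. E (u, 0))) (at \<theta> within Theta S)"
    and "((\<lambda>\<phi>'. F (\<theta>, \<phi>')) has_derivative (\<lambda>v. E (0, v))) (at \<phi> within Phi S)"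
proof -
  show "((\<lambda>\<theta>'. F (\<theta>', \<phi>)) has_derivative (\<lambda>u. E (u, 0))) (at \<theta> within Theta S)"
    by (rule has_derivative_in_compose[where f = "\<lambda>\<theta>'. (\<theta>', \<phi>)"])
      (use \<phi> in \<open>auto intro!: derivative_eq_intros has_derivative_subset[OF assms]\<close>)
  show "((\<lambda>\<phi>'. F (\<theta>, \<phi>')) has_derivative (\<lambda>v. E (0, v))) (at \<phi> within Phi S)"
    by (rule has_derivative_in_compose[where f = "\<lambda>\<phi>'. (\<theta>, \<phi>')"])
      (use \<theta> in \<open>auto intro!: derivative_eq_intros has_derivative_subset[OF assms]\<close>)
qed

lemma jacobian_blocks:
  "J\<theta>p S \<theta> \<phi> h *v u + J\<phi>p S \<theta> \<phi> h *v v = Ep (u, v)"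
  "J\<theta>q S \<theta> \<phi> *v u + J\<phi>q S \<theta> \<phi> *v v = Eq (u, v)"
proof -
  note p = partial_derivatives[OF Ep] and q = partial_derivatives[OF Eq]
  have "Ep (u, v) = Ep (u, 0) + Ep (0, v)" "Eq (u, v) = Eq (u, 0) + Eq (0, v)"
    using linear_add[OF has_derivative_linear[OF Ep], of "(u, 0)" "(0, v)"]
      linear_add[OF has_derivative_linear[OF Eq], of "(u, 0)" "(0, v)"] by simp_all
  moreover have "J\<theta>p S \<theta> \<phi> h *v u = Ep (u, 0)" "J\<theta>q S \<theta> \<phi> *v u = Eq (u, 0)"
    unfolding J\<theta>p_def J\<theta>q_def
    using jacobian_mult_vec_within_convex[OF p(1)] jacobian_mult_vec_within_convex[OF q(1)]
      parameter_sets \<theta> interior by simp_all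
  moreover have "J\<phi>p S \<theta> \<phi> h *v v = Ep (0, v)" "J\<phi>q S \<theta> \<phi> *v v = Eq (0, v)"
    unfolding J\<phi>p_def J\<phi>q_def
    using jacobian_mult_vec_within_convex[OF p(2)] jacobian_mult_vec_within_convex[OF q(2)]
      parameter_sets \<phi> interior by simp_all
  ultimately show "J\<theta>p S \<theta> \<phi> h *v u + J\<phi>p S \<theta> \<phi> h *v v = Ep (u, v)"
    "J\<theta>q S \<theta> \<phi> *v u + J\<phi>q S \<theta> \<phi> *v v = Eq (u, v)" by simp_all
qed

text \<open>A vanishing derivative is orthogonal to everything, in particular to the projection of
  \<open>(u, v)\<close> on the coordinate of the model concerned.\<close>

lemma kernel_estimates:
  "Ep (u, v) = 0 \<Longrightarrow> norm u \<le> \<alpha> * norm (u, v)"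
  "Eq (u, v) = 0 \<Longrightarrow> norm v \<le> \<beta> * norm (u, v)"
proof -
  have K: "convex (Theta S \<times> Phi S)" "(\<theta>, \<phi>) \<in> Theta S \<times> Phi S" "interior (Theta S \<times> Phi S) \<noteq> {}"
    using parameter_sets \<theta> \<phi> interior by (auto simp: convex_Times interior_Times)
  show "norm u \<le> \<alpha> * norm (u, v)" if "Ep (u, v) = 0"
    using decision_dependent_gradient_derivative[OF risk_p_axioms[OF h] linear_fst _ Ep[unfolded Fp_def] K]
      that by auto
  show "norm v \<le> \<beta> * norm (u, v)" if "Eq (u, v) = 0"
    using decision_dependent_gradient_derivative[OF risk_q_axioms linear_snd _ Eq[unfolded Fq_def] K]
      that by auto
qed

lemma joint_kernel_trivial:
  assumes "Ep (u, v) = 0" "Eq (u, v) = 0"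
  shows "u = 0 \<and> v = 0"
proof -
  have "norm (u, v) \<le> norm u + norm v"
    using norm_triangle_ineq[of "(u, 0)" "(0, v)"] by simp
  also have "\<dots> \<le> (\<alpha> + \<beta>) * norm (u, v)"
    using kernel_estimates(1)[OF assms(1)] kernel_estimates(2)[OF assms(2)] by (simp add: distrib_right)
  finally have "(1 - (\<alpha> + \<beta>)) * norm (u, v) \<le> 0"
    by (simp add: left_diff_distrib)
  then have "norm (u, v) \<le> 0"
    using contraction_factor(3) by (simp add: mult_le_0_iff)
  then show ?thesis by (simp add: zero_prod_def)
qed

text \<open>A kernel vector of a diagonal block, padded by 0, is killed by the derivative for that
  model, and \<open>kernel_estimates\<close> with a constant below 1 forces it to vanish. The Schur
  complements reduce to \<open>joint_kernel_trivial\<close>.\<close>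

lemma invertible_jacobians:
  "invertible (J\<theta>p S \<theta> \<phi> h)" "invertible (J\<phi>q S \<theta> \<phi>)"
  "invertible (schur_p S \<theta> \<phi> h)" "invertible (schur_q S \<theta> \<phi> h)"
proof -
  show p: "invertible (J\<theta>p S \<theta> \<phi> h)"
  proof (rule invertible_if_kernel_trivial)
    fix u assume "J\<theta>p S \<theta> \<phi> h *v u = 0"
    then have "Ep (u, 0) = 0" using jacobian_blocks(1)[of u 0] by simp
    from kernel_estimates(1)[OF this] have "(1 - \<alpha>) * norm u \<le> 0"
      by (simp add: left_diff_distrib)
    then show "u = 0" using contraction_factor by (simp add: mult_le_0_iff)
  qed
  show q: "invertible (J\<phi>q S \<theta> \<phi>)"
  proof (rule invertible_if_kernel_trivial)
    fix v assume "J\<phi>q S \<theta> \<phi> *v v = 0"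
    then have "Eq (0, v) = 0" using jacobian_blocks(2)[of 0 v] by simp
    from kernel_estimates(2)[OF this] have "(1 - \<beta>) * norm v \<le> 0"
      by (simp add: left_diff_distrib)
    then show "v = 0" using contraction_factor by (simp add: mult_le_0_iff)
  qed
  show "invertible (schur_p S \<theta> \<phi> h)"
    unfolding schur_p_def
    by (rule invertible_schur_complement[OF q]) (use jacobian_blocks joint_kernel_trivial in metis)
  show "invertible (schur_q S \<theta> \<phi> h)"
    unfolding schur_q_def
    by (rule invertible_schur_complement[OF p])
      (use jacobian_blocks joint_kernel_trivial in \<open>metis add.commute\<close>)
qed

lemma linear_response:
  assumes "Ep (u, v) = r *\<^sub>R c" "Eq (u, v) = 0"
  shows "u = r *\<^sub>R (Sp S \<theta> \<phi> h *v c)" "v = r *\<^sub>R (Sq S \<theta> \<phi> h *v (Cq S \<theta> \<phi> h *v c))"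
proof -
  note inv = invertible_jacobians
  have 1: "J\<theta>p S \<theta> \<phi> h *v u + J\<phi>p S \<theta> \<phi> h *v v = r *\<^sub>R c" "J\<theta>q S \<theta> \<phi> *v u + J\<phi>q S \<theta> \<phi> *v v = 0"
    using assms jacobian_blocks by simp_all
  \<comment> \<open>The same system with \<phi> as the leading unknown, so that elimination now
    removes \<open>u\<close>.\<close>
  then have 2: "J\<phi>q S \<theta> \<phi> *v v + J\<theta>q S \<theta> \<phi> *v u = 0" "J\<phi>p S \<theta> \<phi> h *v v + J\<theta>p S \<theta> \<phi> h *v u = r *\<^sub>R c"
    by (simp_all add: add.commute)
  show "u = r *\<^sub>R (Sp S \<theta> \<phi> h *v c)"
    using block_system_solution[OF inv(2) inv(3)[unfolded schur_p_def] 1]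
    by (simp add: Sp_def schur_p_def matrix_vector_mult_scaleR)
  have "v = Sq S \<theta> \<phi> h *v (- (J\<theta>q S \<theta> \<phi> *v (matrix_inv (J\<theta>p S \<theta> \<phi> h) *v (r *\<^sub>R c))))"
    using block_system_solution[OF inv(1) inv(4)[unfolded schur_q_def] 2]
    by (simp add: Sq_def schur_q_def)
  also have "- (J\<theta>q S \<theta> \<phi> *v (matrix_inv (J\<theta>p S \<theta> \<phi> h) *v (r *\<^sub>R c))) = r *\<^sub>R (Cq S \<theta> \<phi> h *v c)"
    \<comment> \<open>Taking 0 as the first matrix pulls the minus sign of \<open>Cq\<close> out of
      the matrix-vector product.\<close>
    using matrix_vector_mult_diff_rdistrib[of 0 "J\<theta>q S \<theta> \<phi> ** matrix_inv (J\<theta>p S \<theta> \<phi> h)" c]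
    by (simp add: Cq_def matrix_vector_mult_scaleR matrix_vector_mul_assoc)
  finally show "v = r *\<^sub>R (Sq S \<theta> \<phi> h *v (Cq S \<theta> \<phi> h *v c))"
    by (simp add: matrix_vector_mult_scaleR)
qed

end

text \<open>Along the stable curve \<open>Fp\<close> and \<open>Fq\<close> are constantly 0, so
  their total derivatives vanish. Linearity of \<open>E\<close> separates the response of the
  parameters from the direct effect of the weight. The assumption \<open>nontrivial\<close> makes
  derivatives within \<open>I\<close> unique.\<close>

lemma stable_point_derivative:
  assumes stable: "\<forall>k\<in>I. stable_point S k (\<theta>s k) (\<phi>s k) \<and> Fp S (\<theta>s k) (\<phi>s k) k = 0 \<and> Fq S (\<theta>s k) (\<phi>s k) = 0"
    and h: "h \<in> I" and nontrivial: "at h within I \<noteq> bot"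
    and \<theta>': "(\<theta>s has_vector_derivative \<theta>') (at h within I)" and \<phi>': "(\<phi>s has_vector_derivative \<phi>') (at h within I)"
    and E: "((\<lambda>(\<theta>, \<phi>, h). Fp S \<theta> \<phi> h) has_derivative E)
      (at (\<theta>s h, \<phi>s h, h) within Theta S \<times> Phi S \<times> I)"
    and Eq: "((\<lambda>i. Fq S (fst i) (snd i)) has_derivative Eq) (at (\<theta>s h, \<phi>s h) within Theta S \<times> Phi S)"
  shows "E (\<theta>', \<phi>', 0) = (1 / (1 - h)) *\<^sub>R (\<integral>z. - grad_p S (\<theta>s h) z \<partial>cur_p S (\<theta>s h) (\<phi>s h))"
    and "Eq (\<theta>', \<phi>') = 0"
proof -
  let ?C = "\<integral>z. grad_p S (\<theta>s h) z \<partial>cur_p S (\<theta>s h) (\<phi>s h)"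
  have mem: "\<theta>s k \<in> Theta S" "\<phi>s k \<in> Phi S" if "k \<in> I" for k
    using stable that by (auto simp: stable_point_def is_arg_min_def)
  have linE: "linear E" and linEq: "linear Eq"
    using E Eq by (auto intro: has_derivative_linear)
  note \<theta>d = \<theta>'[unfolded has_vector_derivative_def] and \<phi>d = \<phi>'[unfolded has_vector_derivative_def]
  have "((\<lambda>k. (\<lambda>(\<theta>, \<phi>, h). Fp S \<theta> \<phi> h) (\<theta>s k, \<phi>s k, k)) has_derivative
      (\<lambda>t. E (t *\<^sub>R \<theta>', t *\<^sub>R \<phi>', t))) (at h within I)"
    by (rule has_derivative_in_compose[where f = "\<lambda>k. (\<theta>s k, \<phi>s k, k)"])
      (use mem in \<open>auto intro!: has_derivative_Pair \<theta>d \<phi>d has_derivative_subset[OF E]\<close>)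
  moreover have "E (t *\<^sub>R \<theta>', t *\<^sub>R \<phi>', t) = t *\<^sub>R E (\<theta>', \<phi>', 1)" for t
    using linear_scale[OF linE, of t "(\<theta>', \<phi>', 1)"] by simp
  ultimately have "((\<lambda>k. Fp S (\<theta>s k) (\<phi>s k) k) has_vector_derivative E (\<theta>', \<phi>', 1)) (at h within I)"
    by (simp add: has_vector_derivative_def)
  then have "((\<lambda>k. 0) has_vector_derivative E (\<theta>', \<phi>', 1)) (at h within I)"
    by (rule has_vector_derivative_transform[OF h, rotated]) (use stable in simp)
  then have sum0: "E (\<theta>', \<phi>', 1) = 0"
    by (rule vector_derivative_unique_within[OF nontrivial]) (rule has_vector_derivative_const)
  \<comment> \<open>A second curve through the same point: the parameters are frozen and only the
    weight moves. By \<open>Fp_weight_change\<close>, \<open>Fp\<close> is an explicit affine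
    function of \<open>k\<close> along it.\<close>
  have "((\<lambda>k. (\<lambda>(\<theta>, \<phi>, h). Fp S \<theta> \<phi> h) (\<theta>s h, \<phi>s h, k)) has_derivative (\<lambda>t. E (0, 0, t))) (at h within I)"
    by (rule has_derivative_in_compose[where f = "\<lambda>k. (\<theta>s h, \<phi>s h, k)"])
      (use mem[OF h] in \<open>auto intro!: derivative_eq_intros has_derivative_subset[OF E]\<close>)
  moreover have "(\<lambda>t. E (0, 0, t)) = (\<lambda>t. t *\<^sub>R E (0, 0, 1))"
  proof
    show "E (0, 0, t) = t *\<^sub>R E (0, 0, 1)" for t
      using linear_scale[OF linE, of t "(0, 0, 1)"] by simp
  qed
  ultimately have "((\<lambda>k. Fp S (\<theta>s h) (\<phi>s h) k) has_vector_derivative E (0, 0, 1)) (at h within I)"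
    by (simp only: has_vector_derivative_def prod.case)
  then have "((\<lambda>k. ((k - h) / (1 - h)) *\<^sub>R ?C) has_vector_derivative E (0, 0, 1)) (at h within I)"
    by (rule has_vector_derivative_transform[OF h, rotated])
      (use stable h mem[OF h] in \<open>simp add: Fp_weight_change[OF h]\<close>)
  moreover have "((\<lambda>k. ((k - h) / (1 - h)) *\<^sub>R ?C) has_vector_derivative (1 / (1 - h)) *\<^sub>R ?C) (at h within I)"
    using weights(2)[OF h]
    by (auto simp: has_vector_derivative_def divide_inverse intro!: derivative_eq_intros)
  ultimately have "E (0, 0, 1) = (1 / (1 - h)) *\<^sub>R ?C"
    by (rule vector_derivative_unique_within[OF nontrivial])
  moreover have "E (\<theta>', \<phi>', 1) = E (\<theta>', \<phi>', 0) + E (0, 0, 1)"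
    using linear_add[OF linE, of "(\<theta>', \<phi>', 0)" "(0, 0, 1)"] by simp
  ultimately show "E (\<theta>', \<phi>', 0) = (1 / (1 - h)) *\<^sub>R (\<integral>z. - grad_p S (\<theta>s h) z \<partial>cur_p S (\<theta>s h) (\<phi>s h))"
    using sum0 by (simp add: eq_neg_iff_add_eq_0)
  have "((\<lambda>k. (\<lambda>i. Fq S (fst i) (snd i)) (\<theta>s k, \<phi>s k)) has_derivative
      (\<lambda>t. Eq (t *\<^sub>R \<theta>', t *\<^sub>R \<phi>'))) (at h within I)"
    by (rule has_derivative_in_compose[where f = "\<lambda>k. (\<theta>s k, \<phi>s k)"])
      (use mem in \<open>auto intro!: has_derivative_Pair \<theta>d \<phi>d has_derivative_subset[OF Eq]\<close>)
  moreover have "Eq (t *\<^sub>R \<theta>', t *\<^sub>R \<phi>') = t *\<^sub>R Eq (\<theta>', \<phi>')" for t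
    using linear_scale[OF linEq, of t "(\<theta>', \<phi>')"] by simp
  ultimately have "((\<lambda>k. Fq S (\<theta>s k) (\<phi>s k)) has_vector_derivative Eq (\<theta>', \<phi>')) (at h within I)"
    by (simp add: has_vector_derivative_def)
  then have "((\<lambda>k. 0) has_vector_derivative Eq (\<theta>', \<phi>')) (at h within I)"
    by (rule has_vector_derivative_transform[OF h, rotated]) (use stable in simp)
  then show "Eq (\<theta>', \<phi>') = 0"
    by (rule vector_derivative_unique_within[OF nontrivial]) (rule has_vector_derivative_const)
qed

end

section \<open>Alignment along the curve of stable points\<close>

lemma has_real_derivative_compose_gradient:
  fixes f :: "'a::real_inner \<Rightarrow> real"
  assumes J: "has_gradient f D (at (c h) within A)" and c: "(c has_vector_derivative c') (at h within I)"
    and "\<And>k. k \<in> I \<Longrightarrow> c k \<in> A"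
  shows "((\<lambda>h. f (c h)) has_real_derivative D \<bullet> c') (at h within I)"
proof -
  have "((\<lambda>h. f (c h)) has_derivative (\<lambda>t. D \<bullet> (t *\<^sub>R c'))) (at h within I)"
    by (rule has_derivative_in_compose[OF c[unfolded has_vector_derivative_def]])
      (use assms in \<open>auto simp: has_gradient_def intro: has_derivative_subset\<close>)
  moreover have "(\<lambda>t. D \<bullet> (t *\<^sub>R c')) = (*) (D \<bullet> c')"
    by auto
  ultimately show ?thesis
    by (simp only: has_field_derivative_def)
qed

theorem theorem4p5:
  fixes S :: "('m::finite, 'n::finite, 'x::{real_normed_vector, second_countable_topology},
               'y::{real_normed_vector, second_countable_topology}) system"
    and I :: "real set"
    and \<gamma>\<theta> L\<theta> \<epsilon>\<theta> \<gamma>\<phi> L\<phi> \<epsilon>\<phi> :: real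
  assumes "admissible S I"
    and "\<gamma>\<theta> > 0" "L\<theta> \<ge> 0" "\<epsilon>\<theta> \<ge> 0" "\<gamma>\<phi> > 0" "L\<phi> \<ge> 0" "\<epsilon>\<phi> \<ge> 0"
    and "strongly_convex_loss \<gamma>\<theta> (Theta S) (loss_p S) (grad_p S)"
    and "smooth_loss L\<theta> (Theta S) (grad_p S)"
    and "strongly_convex_loss \<gamma>\<phi> (Phi S) (loss_q S) (grad_q S)"
    and "smooth_loss L\<phi> (Phi S) (grad_q S)"
    and "\<forall>h\<in>I. sensitive \<epsilon>\<theta> (Theta S) (Phi S) (train_p S h)"
    and "sensitive \<epsilon>\<phi> (Theta S) (Phi S) (train_q S)"
    and "kappa \<gamma>\<theta> L\<theta> \<epsilon>\<theta> \<gamma>\<phi> L\<phi> \<epsilon>\<phi> < 1"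
  shows "(\<forall>h\<in>I. \<exists>\<theta> \<phi>. stable_point S h \<theta> \<phi> \<and> converges_to S h \<theta> \<phi>) \<and>
    (\<forall>\<theta>s \<phi>s.
       (\<forall>h\<in>I. stable_point S h (\<theta>s h) (\<phi>s h) \<and> converges_to S h (\<theta>s h) (\<phi>s h) \<and>
              Fp S (\<theta>s h) (\<phi>s h) h = 0 \<and> Fq S (\<theta>s h) (\<phi>s h) = 0) \<longrightarrow>
       (\<forall>h\<in>I. regular_at S I \<theta>s \<phi>s h \<longrightarrow>
          invertible (J\<theta>p S (\<theta>s h) (\<phi>s h) h) \<and> invertible (J\<phi>q S (\<theta>s h) (\<phi>s h)) \<and>
          invertible (schur_p S (\<theta>s h) (\<phi>s h) h) \<and> invertible (schur_q S (\<theta>s h) (\<phi>s h) h) \<and>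
          (\<forall>gJp. has_gradient (align_p S) gJp (at (\<theta>s h) within Theta S) \<longrightarrow>
             ((\<lambda>h. align_p S (\<theta>s h)) has_real_derivative
               1 / (1 - h) * (gJp \<bullet> (Sp S (\<theta>s h) (\<phi>s h) h *v
                 (\<integral>z. - grad_p S (\<theta>s h) z \<partial>cur_p S (\<theta>s h) (\<phi>s h))))) (at h within I)) \<and>
          (\<forall>gJq. has_gradient (align_q S) gJq (at (\<phi>s h) within Phi S) \<longrightarrow>
             ((\<lambda>h. align_q S (\<phi>s h)) has_real_derivative
               1 / (1 - h) * (gJq \<bullet> (Sq S (\<theta>s h) (\<phi>s h) h *v (Cq S (\<theta>s h) (\<phi>s h) h *v
                 (\<integral>z. - grad_p S (\<theta>s h) z \<partial>cur_p S (\<theta>s h) (\<phi>s h)))))) (at h within I))))"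
    (is "_ \<and> (\<forall>\<theta>s \<phi>s. ?zero \<theta>s \<phi>s \<longrightarrow> (\<forall>h\<in>I. regular_at S I \<theta>s \<phi>s h \<longrightarrow> ?response \<theta>s \<phi>s h))")
proof -
  interpret self_consuming_system S I \<gamma>\<theta> L\<theta> \<epsilon>\<theta> \<gamma>\<phi> L\<phi> \<epsilon>\<phi>
    using assms by (rule self_consuming_system.intro)
  have "?response \<theta>s \<phi>s h" if zero: "?zero \<theta>s \<phi>s" and h: "h \<in> I" and reg: "regular_at S I \<theta>s \<phi>s h"
    for \<theta>s \<phi>s h
  proof -
    let ?c = "\<integral>z. - grad_p S (\<theta>s h) z \<partial>cur_p S (\<theta>s h) (\<phi>s h)"
    have mem: "\<theta>s k \<in> Theta S" "\<phi>s k \<in> Phi S" if "k \<in> I" for k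
      using zero that by (auto simp: stable_point_def is_arg_min_def)
    have interior: "interior (Theta S) \<noteq> {}" "interior (Phi S) \<noteq> {}"
      using reg by (auto simp: regular_at_def)
    obtain \<theta>' \<phi>' where \<theta>': "(\<theta>s has_vector_derivative \<theta>') (at h within I)"
      and \<phi>': "(\<phi>s has_vector_derivative \<phi>') (at h within I)"
      using reg by (auto simp: regular_at_def vector_derivative_works)
    obtain E where E: "((\<lambda>(\<theta>, \<phi>, h). Fp S \<theta> \<phi> h) has_derivative E)
        (at (\<theta>s h, \<phi>s h, h) within Theta S \<times> Phi S \<times> I)"
      using reg by (auto simp: regular_at_def differentiable_def)
    obtain Eq where Eq: "((\<lambda>i. Fq S (fst i) (snd i)) has_derivative Eq)
        (at (\<theta>s h, \<phi>s h) within Theta S \<times> Phi S)"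
      using reg by (auto simp: regular_at_def differentiable_def case_prod_unfold)
    \<comment> \<open>Restricting the joint derivative \<open>E\<close> to the slice of constant
      weight gives the derivative in the two parameters alone.\<close>
    have "((\<lambda>i. (\<lambda>(\<theta>, \<phi>, h). Fp S \<theta> \<phi> h) (fst i, snd i, h)) has_derivative (\<lambda>w. E (fst w, snd w, 0)))
        (at (\<theta>s h, \<phi>s h) within Theta S \<times> Phi S)"
      by (rule has_derivative_in_compose[where f = "\<lambda>i. (fst i, snd i, h)"])
        (use h in \<open>auto intro!: derivative_eq_intros has_derivative_subset[OF E]\<close>)
    then have Ep: "((\<lambda>i. Fp S (fst i) (snd i) h) has_derivative (\<lambda>w. E (fst w, snd w, 0)))
        (at (\<theta>s h, \<phi>s h) within Theta S \<times> Phi S)"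
      by simp
    note hyps = h mem[OF h] interior Ep Eq
    have response: "\<theta>' = (1 / (1 - h)) *\<^sub>R (Sp S (\<theta>s h) (\<phi>s h) h *v ?c)"
      "\<phi>' = (1 / (1 - h)) *\<^sub>R (Sq S (\<theta>s h) (\<phi>s h) h *v (Cq S (\<theta>s h) (\<phi>s h) h *v ?c))"
      if "at h within I \<noteq> bot"
    proof -
      have "\<forall>k\<in>I. stable_point S k (\<theta>s k) (\<phi>s k) \<and> Fp S (\<theta>s k) (\<phi>s k) k = 0 \<and> Fq S (\<theta>s k) (\<phi>s k) = 0"
        using zero by blast
      from stable_point_derivative[OF this h that \<theta>' \<phi>' E Eq]
      show "\<theta>' = (1 / (1 - h)) *\<^sub>R (Sp S (\<theta>s h) (\<phi>s h) h *v ?c)"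
        "\<phi>' = (1 / (1 - h)) *\<^sub>R (Sq S (\<theta>s h) (\<phi>s h) h *v (Cq S (\<theta>s h) (\<phi>s h) h *v ?c))"
        by (rule linear_response[OF hyps, unfolded fst_conv snd_conv])+
    qed
    have p: "((\<lambda>h. align_p S (\<theta>s h)) has_real_derivative
        1 / (1 - h) * (gJp \<bullet> (Sp S (\<theta>s h) (\<phi>s h) h *v ?c))) (at h within I)"
      if "has_gradient (align_p S) gJp (at (\<theta>s h) within Theta S)" for gJp
    \<comment> \<open>If \<open>h\<close> is isolated in \<open>I\<close>, every number is a
      derivative within \<open>I\<close> and the claim is trivial; otherwise the response formula
      applies.\<close>
    proof (cases "at h within I = bot")
      case False
      then show ?thesis
        using has_real_derivative_compose_gradient[OF that \<theta>' mem(1)] by (simp add: response(1))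
    qed simp
    have q: "((\<lambda>h. align_q S (\<phi>s h)) has_real_derivative
        1 / (1 - h) * (gJq \<bullet> (Sq S (\<theta>s h) (\<phi>s h) h *v (Cq S (\<theta>s h) (\<phi>s h) h *v ?c)))) (at h within I)"
      if "has_gradient (align_q S) gJq (at (\<phi>s h) within Phi S)" for gJq
    proof (cases "at h within I = bot")
      case False
      then show ?thesis
        using has_real_derivative_compose_gradient[OF that \<phi>' mem(2)] by (simp add: response(2))
    qed simp
    show ?thesis
      using invertible_jacobians[OF hyps] p q by blast
  qed
  then show ?thesis
    using ex_stable_point by blast
qed

end
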